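(* Let $1\le r<n$. Let $\mathcal{A}:\mathbb{R}^{n\times n}\to\mathbb{R}^{m}$ be linear, let $M^{\star}\in\mathbb{R}^{n\times n}$ be positive semidefinite with $r^{\star}:=\mathrm{rank}(M^{\star})\le r$, let $b=\mathcal{A}(M^{\star})$, and let $\mathcal{A}$ satisfy $(\delta,r+r^{\star})$-RIP. Define $f_{\mathcal{A}}:\mathbb{R}^{n\times r}\to\mathbb{R}$ by $f_{\mathcal{A}}(X)=\|\mathcal{A}(XX^{T})-b\|^{2}$. \begin{itemize} \item If $\delta<1/(1+\sqrt{r^{\star}/r})$, then for every $X\in\mathbb{R}^{n\times r}$: $\nabla f_{\mathcal{A}}(X)=0$ and $\nabla^{2}f_{\mathcal{A}}(X)\succeq0$ hold if and only if $XX^{T}=M^{\star}$. \item If $\delta\ge1/(1+1/\sqrt{r-r^{\star}+1})$ (and $\delta<1$), then there exist a linear map $\mathcal{A}^{\star}:\mathbb{R}^{n\times n}\to\mathbb{R}^{m}$ (for some $m$) satisfying $(\delta,r+r^{\star})$-RIP, a positive semidefinite $M^{\star}\in\mathbb{R}^{n\times n}$ with $\mathrm{rank}(M^{\star})=r^{\star}$, and $X\in\mathbb{R}^{n\times r}$ with $XX^{T}\ne M^{\star}$ such that, with $f_{\mathcal{A}^{\star}}(U):=\|\mathcal{A}^{\star}(UU^{T}-M^{\star})\|^{2}$, we have $f_{\mathcal{A}^{\star}}(X)>0$, $\nabla f_{\mathcal{A}^{\star}}(X)=0$ and $\nabla^{2}f_{\mathcal{A}^{\star}}(X)\succeq0$.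 \end{itemize}
   Context: A linear map $\mathcal{A}:\mathbb{R}^{n\times n}\to\mathbb{R}^{m}$ satisfies $(\delta,p)$-RIP (restricted isometry property) if $0\le\delta<1$ and there is a rescaling $\nu>0$ such that $(1-\delta)\|E\|_{F}^{2}\le\frac{1}{\nu}\|\mathcal{A}(E)\|^{2}\le(1+\delta)\|E\|_{F}^{2}$ for all $E\in\mathbb{R}^{n\times n}$ with $\mathrm{rank}(E)\le p$. Here $\nabla f$ and $\nabla^{2}f$ denote the gradient and Hessian of $f$ as a function on $\mathbb{R}^{n\times r}$, and $\nabla^{2}f(X)\succeq0$ means the Hessian quadratic form is nonnegative.
   Formalization: In the second bullet the formal statement additionally assumes r* ≥ 1; for r* = 0 one has M* = 0 and ⟨∇f(X),X⟩ = 4f(X), so no critical point with f(X) > 0 exists and the claim as written fails there. *)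

theory Defs
  imports "HOL-Analysis.Analysis"
begin

text \<open>Matrices in R^(n x k) are elements of real^'k^'n (rows indexed by 'n).
  The inner product on real^'n^'n is the Frobenius inner product and norm is
  the Frobenius norm.\<close>

definition psd :: "real^'n^'n \<Rightarrow> bool" where
  "psd M \<longleftrightarrow> transpose M = M \<and> (\<forall>x. 0 \<le> x \<bullet> (M *v x))"

text \<open>(delta,p)-RIP, stated for the squared-norm map q E = norm (A E)^2 of the
  linear measurement operator A.\<close>
definition RIP :: "real \<Rightarrow> nat \<Rightarrow> (real^'n^'n \<Rightarrow> real) \<Rightarrow> bool" where
  "RIP \<delta> p q \<longleftrightarrow> 0 \<le> \<delta> \<and> \<delta> < 1 \<and>
     (\<exists>\<nu>>0. \<forall>E. rank E \<le> p \<longrightarrow>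
        (1 - \<delta>) * (norm E)^2 \<le> q E / \<nu> \<and> q E / \<nu> \<le> (1 + \<delta>) * (norm E)^2)"

text \<open>Squared Euclidean norm of the measurement map R^(n x n) -> R^m given by
  sensing matrices As 0, ..., As (m-1): E |-> (<As i, E>)_{i<m}.
  Every linear map R^(n x n) -> R^m is of this form.\<close>
definition meas_sq :: "nat \<Rightarrow> (nat \<Rightarrow> real^'n^'n) \<Rightarrow> real^'n^'n \<Rightarrow> real" where
  "meas_sq m As E = (\<Sum>i<m. (As i \<bullet> E)^2)"

definition grad_zero :: "('a::real_normed_vector \<Rightarrow> real) \<Rightarrow> 'a \<Rightarrow> bool" where
  "grad_zero f X \<longleftrightarrow> (f has_derivative (\<lambda>H. 0)) (at X)"

definition hess_psd :: "('a::real_normed_vector \<Rightarrow> real) \<Rightarrow> 'a \<Rightarrow> bool" where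
  "hess_psd f X \<longleftrightarrow> (\<forall>H. 0 \<le> deriv (deriv (\<lambda>t. f (X + t *\<^sub>R H))) 0)"

end

theory Submission
  imports Defs
begin

text \<open>
  Let \<open>q\<close> be the squared norm of the measurement map, rescaled by \<open>\<nu>\<close>, with polar form \<open>B\<close>, and
  \<open>E = X X\<^sup>T - M\<close>. Write \<open>M\<close> as a sum of \<open>r*\<close> terms \<open>z\<^sub>i z\<^sub>i\<^sup>T\<close>, where \<open>z\<^sub>i = p\<^sub>i + g\<^sub>i\<close> with \<open>p\<^sub>i\<close> in the
  range of \<open>X\<close> and the \<open>g\<^sub>i\<close> orthogonal to that range and to each other, and put
  \<open>G = \<Sum> g\<^sub>i g\<^sub>i\<^sup>T\<close> and \<open>T = E + G\<close>. The matrix \<open>T\<close> is a tangent direction, so \<open>B(E, T) = 0\<close>. If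
  \<open>u\<close> is a unit vector minimising \<open>\<tau> = |X u|\<^sup>2\<close>, the Hessian along \<open>g\<^sub>i u\<^sup>T\<close> gives
  \<open>B(E, G) \<ge> -(1 + \<delta>) \<tau> \<Sum> d\<^sub>i\<close> with \<open>d\<^sub>i = |g\<^sub>i|\<^sup>2\<close>. Comparing with the restricted isometry bounds
  at \<open>T \<plusminus> \<delta> G\<close> yields \<open>(1 - \<delta>) (|T|\<^sup>2 + \<delta>\<^sup>2 \<Sum> d\<^sub>i\<^sup>2) \<le> 2 \<delta>\<^sup>2 \<tau> \<Sum> d\<^sub>i\<close>. On the other hand
  \<open>|T|\<^sup>2\<close> is bounded below in terms of \<open>\<tau>\<close> and the \<open>d\<^sub>i\<close> through an orthonormal basis of the range
  of \<open>X\<close> adapted to the flag of the \<open>p\<^sub>i\<close>, and for \<open>\<delta>\<close> below the threshold the two bounds are only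
  compatible if \<open>E = 0\<close>.

  The counterexample has \<open>X\<close> an isometric inclusion of coordinates and \<open>M\<close> diagonal, sharing
  \<open>r* - 1\<close> of these coordinates and having one entry \<open>1 + \<kappa>\<close> outside, \<open>\<kappa>\<^sup>2 = r - r* + 1\<close>. The
  form is the multiple \<open>1 + 2 \<kappa>\<close> of the Frobenius form with its eigenvalue lowered to 1 in one
  direction, chosen such that \<open>B(E, F)\<close> only depends on the outside diagonal entry of \<open>F\<close>.
\<close>

section \<open>Outer products and their Frobenius inner products\<close>

definition outer :: "real^'a \<Rightarrow> real^'b \<Rightarrow> real^'b^'a" where
  "outer x y = (\<chi> i j. x $ i * y $ j)"

lemma outer_vector_mult: "outer x y *v v = (y \<bullet> v) *\<^sub>R x"
  by (simp add: outer_def matrix_vector_mult_def inner_vec_def vec_eq_iff sum_distrib_right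
      sum_distrib_left mult_ac)

lemma inner_outer_left: "outer x y \<bullet> F = x \<bullet> (F *v y)"
  by (simp add: outer_def matrix_vector_mult_def inner_vec_def sum_distrib_left mult_ac)

lemma inner_outer_outer: "outer a b \<bullet> outer c d = (a \<bullet> c) * (b \<bullet> d)"
  by (simp add: inner_outer_left outer_vector_mult inner_commute)

lemma outer_add_right: "outer a (b + c) = outer a b + outer a c"
  by (simp add: outer_def vec_eq_iff algebra_simps)

lemma outer_add_left: "outer (a + b) c = outer a c + outer b c"
  by (simp add: outer_def vec_eq_iff algebra_simps)

lemma matrix_mult_transpose_outer: "X ** transpose (outer g y) = outer (X *v y) g"
  by (simp add: outer_def matrix_matrix_mult_def matrix_vector_mult_def transpose_def vec_eq_iff
      sum_distrib_left sum_distrib_right mult_ac)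

lemma outer_mult_transpose: "outer g y ** transpose X = outer g (X *v y)"
  by (simp add: outer_def matrix_matrix_mult_def matrix_vector_mult_def transpose_def vec_eq_iff
      sum_distrib_left sum_distrib_right mult_ac)

lemma outer_mult_transpose_outer: "outer g u ** transpose (outer g u) = (u \<bullet> u) *\<^sub>R outer g g"
  by (simp add: outer_mult_transpose outer_vector_mult) (simp add: outer_def vec_eq_iff)

lemma rank_le_dim_if_range_subset:
  fixes F :: "real^'n^'m"
  assumes "\<And>x. F *v x \<in> V"
  shows "rank F \<le> dim V"
  unfolding rank_dim_range by (rule dim_subset) (use assms in auto)

section \<open>Orthonormal systems and bases adapted to a flag\<close>

lemma bessel_inequality:
  fixes e :: "'i \<Rightarrow> 'a::real_inner"
  assumes fin: "finite I"
    and orth: "\<And>i j. i \<in> I \<Longrightarrow> j \<in> I \<Longrightarrow> e i \<bullet> e j = (if i = j then 1 else 0)"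
  shows "(\<Sum>i\<in>I. (v \<bullet> e i)^2) \<le> (norm v)^2"
proof -
  let ?w = "\<Sum>i\<in>I. (v \<bullet> e i) *\<^sub>R e i"
  have vw: "v \<bullet> ?w = (\<Sum>i\<in>I. (v \<bullet> e i)^2)"
    by (simp add: inner_sum_right power2_eq_square)
  have "e j \<bullet> ?w = v \<bullet> e j" if "j \<in> I" for j
  proof -
    have "e j \<bullet> ?w = (\<Sum>i\<in>I. if i = j then v \<bullet> e i else 0)"
      unfolding inner_sum_right by (rule sum.cong) (use orth that in auto)
    then show ?thesis using fin that by simp
  qed
  then have ww: "?w \<bullet> ?w = (\<Sum>i\<in>I. (v \<bullet> e i)^2)"
    by (simp add: inner_sum_left power2_eq_square)
  have "0 \<le> (norm (v - ?w))^2" by simp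
  also have "\<dots> = v \<bullet> v - 2 * (v \<bullet> ?w) + ?w \<bullet> ?w"
    using dot_norm_neg[of v ?w] by (simp add: power2_norm_eq_inner)
  finally show ?thesis using vw ww by (simp only: power2_norm_eq_inner)
qed

text \<open>The orthogonal complement of \<open>span T\<close> has codimension at most
  \<open>card T\<close>, so by the dimension formula it meets \<open>W\<close> nontrivially.\<close>

lemma exists_unit_orthogonal:
  fixes W :: "'a::euclidean_space set"
  assumes W: "subspace W" and T: "finite T" "card T < dim W"
  obtains x where "x \<in> W" "norm x = 1" "\<And>y. y \<in> T \<Longrightarrow> x \<bullet> y = 0"
proof -
  define C where "C = {y. \<forall>x\<in>span T. orthogonal x y}"
  have subC: "subspace C"
    unfolding C_def by (simp add: subspace_orthogonal_to_vectors)
  have 1: "dim C + dim (span T) = DIM('a)"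
    using dim_subspace_orthogonal_to_vectors[of "span T" UNIV] by (simp add: C_def)
  have 2: "dim (span T) \<le> card T" using T by (simp add: dim_le_card')
  have 3: "dim {x + y |x y. x \<in> W \<and> y \<in> C} + dim (W \<inter> C) = dim W + dim C"
    by (rule dim_sums_Int[OF W subC])
  have 4: "dim {x + y |x y. x \<in> W \<and> y \<in> C} \<le> DIM('a)"
    by (rule dim_subset_UNIV)
  have "dim (W \<inter> C) > 0"
    using add_mono[OF 4 2] 1 3 T(2) by simp
  then have "\<not> W \<inter> C \<subseteq> {0}" by (simp add: dim_eq_0 flip: neq0_conv)
  then obtain x where x: "x \<in> W" "x \<in> C" "x \<noteq> 0" by auto
  show ?thesis
  proof
    show "x /\<^sub>R norm x \<in> W" using x W by (simp add: subspace_scale)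
    show "norm (x /\<^sub>R norm x) = 1" using x by simp
    show "(x /\<^sub>R norm x) \<bullet> y = 0" if "y \<in> T" for y
      using x that by (auto simp: C_def orthogonal_def span_base inner_commute)
  qed
qed

lemma dim_Int_orthogonal_complement:
  fixes W :: "'a::euclidean_space set"
  assumes W: "subspace W" and e: "e \<in> W" "e \<noteq> 0"
  shows "dim {x \<in> W. e \<bullet> x = 0} = dim W - 1"
proof -
  have "dim {y \<in> W. \<forall>x\<in>span {e}. orthogonal x y} + dim (span {e}) = dim W"
    by (rule dim_subspace_orthogonal_to_vectors) (use W e span_minimal[of "{e}" W] in auto)
  moreover have "{y \<in> W. \<forall>x\<in>span {e}. orthogonal x y} = {x \<in> W. e \<bullet> x = 0}"
    by (auto simp: span_singleton orthogonal_def)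
  moreover have "dim (span {e}) = 1" using e by (simp add: dim_singleton)
  ultimately show ?thesis by simp
qed

text \<open>The basis is built from the last vector downwards: in dimension \<open>Suc m\<close>
  there is room for a unit vector orthogonal to the \<open>m\<close> vectors \<open>z 0\<close>,
  ..., \<open>z (m - 1)\<close>. It receives index \<open>m\<close>, and the induction continues in
  its complement within \<open>W\<close>.\<close>

lemma orthonormal_flag_basis:
  fixes W :: "'a::euclidean_space set" and z :: "nat \<Rightarrow> 'a"
  assumes "subspace W" "dim W = m"
  shows "\<exists>e. (\<forall>j<m. e j \<in> W) \<and> (\<forall>i<m. \<forall>j<m. e i \<bullet> e j = (if i = j then 1 else 0)) \<and>
             (\<forall>j<m. \<forall>i<j. e j \<bullet> z i = 0)"
  using assms
proof (induction m arbitrary: W)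
  case 0
  then show ?case by simp
next
  case (Suc m)
  have "card (z ` {..<m}) < dim W"
    using card_image_le[of "{..<m}" z] Suc.prems by simp
  from exists_unit_orthogonal[OF Suc.prems(1) _ this]
  obtain x where "x \<in> W" "norm x = 1" "\<And>y. y \<in> z ` {..<m} \<Longrightarrow> x \<bullet> y = 0" by blast
  then have x: "x \<in> W" "norm x = 1" "\<And>i. i < m \<Longrightarrow> x \<bullet> z i = 0" by auto
  let ?W = "{y \<in> W. x \<bullet> y = 0}"
  have sub: "subspace ?W"
    using Suc.prems(1) by (auto simp: subspace_def inner_add_right)
  have "x \<noteq> 0" using x by auto
  then have "dim ?W = m"
    using dim_Int_orthogonal_complement[OF Suc.prems(1) x(1)] Suc.prems by simp
  from Suc.IH[OF sub this] obtain e where e: "\<forall>j<m. e j \<in> ?W"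
    "\<forall>i<m. \<forall>j<m. e i \<bullet> e j = (if i = j then 1 else 0)" "\<forall>j<m. \<forall>i<j. e j \<bullet> z i = 0"
    by blast
  show ?case
    by (rule exI[of _ "e(m := x)"])
      (use e x in \<open>auto simp: less_Suc_eq inner_commute norm_eq_1\<close>)
qed

section \<open>Simultaneous diagonalisation of two symmetric forms\<close>

text \<open>The form \<open>b - \<mu> a\<close> is nonnegative on \<open>W\<close> and vanishes at
  \<open>w\<close>. Its values at \<open>w + t v\<close> form a nonnegative quadratic in
  \<open>t\<close> without constant term, so the linear coefficient is zero.\<close>

lemma minimizing_form_orthogonal:
  fixes a b :: "'a::euclidean_space \<Rightarrow> 'a \<Rightarrow> real"
  assumes a: "bilinear a" "\<And>x y. a x y = a y x" and b: "bilinear b" "\<And>x y. b x y = b y x"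
    and W: "subspace W" "w \<in> W" "v \<in> W"
    and min: "\<And>x. x \<in> W \<Longrightarrow> \<mu> * a x x \<le> b x x" and eq: "b w w = \<mu> * a w w"
  shows "b w v = \<mu> * a w v"
proof -
  define \<beta> where "\<beta> = b w v - \<mu> * a w v"
  define \<gamma> where "\<gamma> = b v v - \<mu> * a v v"
  have key: "0 \<le> 2 * t * \<beta> + t^2 * \<gamma>" for t
  proof -
    have "w + t *\<^sub>R v \<in> W" using W by (simp add: subspace_add subspace_scale)
    from min[OF this] show ?thesis
      using eq a(2)[of v w] b(2)[of v w]
      by (simp add: \<beta>_def \<gamma>_def bilinear_ladd[OF a(1)] bilinear_radd[OF a(1)] bilinear_lmul[OF a(1)]
          bilinear_rmul[OF a(1)] bilinear_ladd[OF b(1)] bilinear_radd[OF b(1)] bilinear_lmul[OF b(1)]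
          bilinear_rmul[OF b(1)] algebra_simps power2_eq_square)
  qed
  have "\<gamma> \<ge> 0" using min[OF W(3)] by (simp add: \<gamma>_def)
  \<comment> \<open>Any small step against the sign of \<open>\<beta>\<close> makes the quadratic
    negative unless \<open>\<beta> = 0\<close>; the denominator \<open>1 + \<gamma>\<close> rather
    than \<open>\<gamma>\<close> also covers \<open>\<gamma> = 0\<close>.\<close>
  have "0 \<le> 2 * (- \<beta> / (1 + \<gamma>)) * \<beta> + (- \<beta> / (1 + \<gamma>))^2 * \<gamma>" by (rule key)
  also have "\<dots> = - (\<beta>^2 * (2 + \<gamma>) / (1 + \<gamma>)^2)"
    using \<open>\<gamma> \<ge> 0\<close> by (simp add: divide_simps power2_eq_square) (simp add: algebra_simps)
  finally have "\<beta>^2 * (2 + \<gamma>) / (1 + \<gamma>)^2 \<le> 0" by simp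
  then have "\<beta> = 0" using \<open>\<gamma> \<ge> 0\<close>
    by (smt (verit) divide_pos_pos mult_pos_pos zero_less_power zero_less_power2)
  then show ?thesis by (simp add: \<beta>_def)
qed

text \<open>The first vector minimises the Rayleigh quotient of \<open>b\<close> with respect to
  \<open>a\<close>, which exists by compactness of the unit sphere of \<open>W\<close>. By the
  preceding lemma its \<open>a\<close>-complement is also \<open>b\<close>-orthogonal to it, so the
  induction continues there.\<close>

lemma simultaneous_diagonalization:
  fixes a b :: "'a::euclidean_space \<Rightarrow> 'a \<Rightarrow> real"
  assumes a: "bilinear a" "\<And>x y. a x y = a y x" and b: "bilinear b" "\<And>x y. b x y = b y x"
    and "subspace W" "dim W = m" and "\<forall>x\<in>W. x \<noteq> 0 \<longrightarrow> 0 < a x x"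
  shows "\<exists>w. (\<forall>i<m. w i \<in> W) \<and> (\<forall>i<m. \<forall>j<m. a (w i) (w j) = (if i = j then 1 else 0)) \<and>
      (\<forall>i<m. \<forall>j<m. i \<noteq> j \<longrightarrow> b (w i) (w j) = 0) \<and>
      (\<forall>i j. i \<le> j \<longrightarrow> j < m \<longrightarrow> b (w i) (w i) \<le> b (w j) (w j)) \<and>
      (\<forall>x\<in>W. x = (\<Sum>i<m. a (w i) x *\<^sub>R w i))"
  using assms(5-7)
proof (induction m arbitrary: W)
  case 0
  then have "W \<subseteq> {0}" by simp
  then show ?case by auto
next
  case (Suc m)
  note W = Suc.prems(1) and dimW = Suc.prems(2)
  have pos: "0 < a x x" if "x \<in> W" "x \<noteq> 0" for x using Suc.prems(3) that by blast
  let ?S = "sphere 0 1 \<inter> W"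
  let ?R = "\<lambda>x. b x x / a x x"
  have pos': "0 < a x x" if "x \<in> ?S" for x
    using that by (intro pos) auto
  have bba: "bounded_bilinear a" and bbb: "bounded_bilinear b"
    using a b by (simp_all add: bilinear_conv_bounded_bilinear)
  have cont: "continuous_on ?S ?R"
    by (intro continuous_on_divide bounded_bilinear.continuous_on[OF bba]
        bounded_bilinear.continuous_on[OF bbb] continuous_on_id) (use pos' in force)
  have cpt: "compact ?S" using W by (intro compact_Int_closed compact_sphere closed_subspace)
  obtain x0 where "x0 \<in> W" "norm x0 = 1"
    using exists_unit_orthogonal[OF W, of "{}"] dimW by auto
  then have "?S \<noteq> {}" by auto
  from continuous_attains_inf[OF cpt this cont]
  obtain x where x: "x \<in> ?S" and xmin: "\<And>y. y \<in> ?S \<Longrightarrow> ?R x \<le> ?R y" by blast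
  define \<mu> where "\<mu> = ?R x"
  have min: "\<mu> * a y y \<le> b y y" if "y \<in> W" for y
  proof (cases "y = 0")
    case True
    then show ?thesis by (simp add: bilinear_lzero[OF a(1)] bilinear_lzero[OF b(1)])
  next
    case False
    have "y /\<^sub>R norm y \<in> ?S" using that False W by (simp add: subspace_scale)
    from xmin[OF this] have "\<mu> \<le> b y y / a y y"
      using False by (simp add: \<mu>_def bilinear_lmul[OF a(1)] bilinear_rmul[OF a(1)] bilinear_lmul[OF b(1)]
          bilinear_rmul[OF b(1)])
    then show ?thesis using pos[OF that False] by (simp add: pos_le_divide_eq)
  qed
  have xW: "x \<in> W" and ax: "0 < a x x" using x pos' by auto
  define w0 where "w0 = x /\<^sub>R sqrt (a x x)"
  have w0W: "w0 \<in> W" using xW W by (simp add: w0_def subspace_scale)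
  have aw0: "a w0 w0 = 1"
    using ax by (simp add: w0_def bilinear_lmul[OF a(1)] bilinear_rmul[OF a(1)] divide_simps)
  have bw0: "b w0 w0 = \<mu>"
    using ax by (simp add: w0_def \<mu>_def bilinear_lmul[OF b(1)] bilinear_rmul[OF b(1)] divide_simps)
  have orth: "b w0 v = \<mu> * a w0 v" if "v \<in> W" for v
    by (rule minimizing_form_orthogonal[OF a b W w0W that]) (use min aw0 bw0 in auto)
  let ?W = "{y \<in> W. a w0 y = 0}"
  have sub: "subspace ?W"
    using W by (auto simp: subspace_def bilinear_rzero[OF a(1)] bilinear_radd[OF a(1)] bilinear_rmul[OF a(1)])
  have proj: "y - a w0 y *\<^sub>R w0 \<in> ?W" if "y \<in> W" for y
    using that w0W W aw0
    by (simp add: subspace_diff subspace_scale bilinear_rsub[OF a(1)] bilinear_rmul[OF a(1)])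
  have "W \<subseteq> span (insert w0 ?W)"
  proof
    fix y assume "y \<in> W"
    then have "(y - a w0 y *\<^sub>R w0) + a w0 y *\<^sub>R w0 \<in> span (insert w0 ?W)"
      using proj by (intro span_add span_scale) (auto intro: span_base)
    then show "y \<in> span (insert w0 ?W)" by simp
  qed
  then have "dim W \<le> dim (insert w0 ?W)" by (metis dim_span dim_subset)
  moreover have "dim ?W < dim W"
  proof (rule ccontr)
    assume "\<not> ?thesis"
    then have "dim W \<le> dim ?W" by simp
    from subspace_dim_equal[OF sub W _ this] have "?W = W" by auto
    then have "a w0 w0 = 0" using w0W by blast
    then show False using aw0 by simp
  qed
  ultimately have dim: "dim ?W = m" using dimW by (simp add: dim_insert split: if_splits)
  from Suc.IH[OF sub dim] pos obtain w where w: "\<forall>i<m. w i \<in> ?W"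
    "\<forall>i<m. \<forall>j<m. a (w i) (w j) = (if i = j then 1 else 0)"
    "\<forall>i<m. \<forall>j<m. i \<noteq> j \<longrightarrow> b (w i) (w j) = 0"
    "\<forall>i j. i \<le> j \<longrightarrow> j < m \<longrightarrow> b (w i) (w i) \<le> b (w j) (w j)"
    "\<forall>x\<in>?W. x = (\<Sum>i<m. a (w i) x *\<^sub>R w i)"
    by auto
  \<comment> \<open>The minimiser takes index 0 and the inductive system is shifted by one. As
    \<open>\<mu>\<close> is minimal on all of \<open>W\<close>, the values of \<open>b\<close> are
    then ascending.\<close>
  define w' where "w' = (\<lambda>i. case i of 0 \<Rightarrow> w0 | Suc i \<Rightarrow> w i)"
  have b0: "b w0 (w i) = 0" "b (w i) w0 = 0" "a (w i) w0 = 0" "a w0 (w i) = 0" if "i < m" for i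
    using orth[of "w i"] w(1) that a(2)[of "w i"] b(2)[of "w i"] by auto
  have b1: "b w0 w0 \<le> b (w i) (w i)" if "i < m" for i
    using min[of "w i"] w(1,2) that bw0 by auto
  show ?case
  proof (rule exI[of _ w'], intro conjI allI impI ballI)
    show "y = (\<Sum>i<Suc m. a (w' i) y *\<^sub>R w' i)" if "y \<in> W" for y
    proof -
      have "y - a w0 y *\<^sub>R w0 = (\<Sum>i<m. a (w i) (y - a w0 y *\<^sub>R w0) *\<^sub>R w i)"
        using w(5) proj[OF that] by blast
      also have "\<dots> = (\<Sum>i<m. a (w i) y *\<^sub>R w i)"
        using b0 by (simp add: bilinear_rsub[OF a(1)] bilinear_rmul[OF a(1)])
      finally show ?thesis
        by (simp add: w'_def sum.lessThan_Suc_shift algebra_simps del: sum.lessThan_Suc)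
    qed
    show "w' i \<in> W" if "i < Suc m" for i using that w0W w(1) by (auto simp: w'_def split: nat.splits)
    show "a (w' i) (w' j) = (if i = j then 1 else 0)" if "i < Suc m" "j < Suc m" for i j
      using that w b0 aw0 by (auto simp: w'_def split: nat.splits)
    show "b (w' i) (w' j) = 0" if "i < Suc m" "j < Suc m" "i \<noteq> j" for i j
      using that w b0 by (auto simp: w'_def split: nat.splits)
    show "b (w' i) (w' i) \<le> b (w' j) (w' j)" if "i \<le> j" "j < Suc m" for i j
      using that w(4) b1 by (auto simp: w'_def split: nat.splits)
  qed
qed

section \<open>Splitting a positive semidefinite matrix along a subspace\<close>

lemma exists_orthogonal_projection:
  fixes V :: "'a::euclidean_space set"
  assumes V: "subspace V"
  obtains P where "linear P" "\<And>v. P v \<in> V" "\<And>v x. x \<in> V \<Longrightarrow> (v - P v) \<bullet> x = 0"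
proof -
  obtain B where B: "B \<subseteq> V" "pairwise orthogonal B" "\<And>x. x \<in> B \<Longrightarrow> norm x = 1"
    "independent B" "card B = dim V" "span B = V"
    using orthonormal_basis_subspace[OF V] by metis
  have finB: "finite B" using B(4) by (rule independent_imp_finite)
  define P where "P = (\<lambda>v. \<Sum>b\<in>B. (v \<bullet> b) *\<^sub>R b)"
  show ?thesis
  proof
    show "linear P"
      by (rule linearI)
        (simp_all add: P_def inner_add_left scaleR_add_left sum.distrib scaleR_sum_right)
    show "P v \<in> V" for v
      unfolding P_def by (intro subspace_sum[OF V] subspace_scale[OF V]) (use B(1) in auto)
    show "(v - P v) \<bullet> x = 0" if "x \<in> V" for v x
    proof -
      have "(v - P v) \<bullet> b = 0" if b: "b \<in> B" for b
      proof -
        have "P v \<bullet> b = (\<Sum>c\<in>B. if c = b then v \<bullet> b else 0)"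
          unfolding P_def inner_sum_left
          by (rule sum.cong)
            (use B(2,3) b in \<open>auto simp: pairwise_def orthogonal_def norm_eq_1\<close>)
        then show ?thesis using b finB by (simp add: inner_diff_left)
      qed
      moreover have "x \<in> span B" using that B by simp
      ultimately show ?thesis
        using orthogonal_to_span[of x B "v - P v"] by (auto simp: orthogonal_def)
    qed
  qed
qed

lemma psd_inner_commute: "psd M \<Longrightarrow> u \<bullet> (M *v v) = v \<bullet> (M *v u)"
  unfolding psd_def by (metis dot_lmul_matrix inner_commute transpose_matrix_vector)

lemma bilinear_inner_linear:
  assumes "linear f" "linear g" shows "bilinear (\<lambda>u v. f u \<bullet> g v)"
  using assms by (auto simp: bilinear_def linear_iff inner_add_left inner_add_right)

text \<open>The vector \<open>w\<close> minimises the nonnegative form of \<open>M\<close>, so the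
  variational lemma applies with \<open>\<mu> = 0\<close> and the standard inner product as
  \<open>a\<close>.\<close>

lemma psd_kernel:
  assumes "psd M" "w \<bullet> (M *v w) = 0"
  shows "M *v w = 0"
proof -
  have "(M *v w) \<bullet> v = 0" for v
  proof -
    have "w \<bullet> (M *v v) = 0 * (w \<bullet> v)"
      by (rule minimizing_form_orthogonal[where a = "\<lambda>u v. u \<bullet> v" and W = UNIV])
        (use assms in \<open>auto simp: psd_def inner_commute psd_inner_commute[OF assms(1)]
            intro!: bilinear_inner_linear linear_id[unfolded id_def]\<close>)
    then show ?thesis using psd_inner_commute[OF assms(1), of w v] by (simp add: inner_commute)
  qed
  then show ?thesis by (metis inner_eq_zero_iff)
qed

text \<open>Diagonalise, simultaneously on the range of \<open>M\<close>, the form of \<open>M\<close> and the form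
  \<open>u, v \<mapsto> Q M u \<bullet> Q M v\<close>, where \<open>Q\<close> projects along \<open>V\<close>.\<close>
lemma psd_adapted_decomposition:
  fixes M :: "real^'n^'n"
  assumes psd: "psd M" and V: "subspace V"
  obtains p g :: "nat \<Rightarrow> real^'n" where
    "M = (\<Sum>i<rank M. outer (p i + g i) (p i + g i))"
    "\<And>i. p i \<in> V" "\<And>i x. x \<in> V \<Longrightarrow> g i \<bullet> x = 0"
    "\<And>i. p i + g i \<in> range (\<lambda>x. M *v x)"
    "\<And>i j. i < rank M \<Longrightarrow> j < rank M \<Longrightarrow> i \<noteq> j \<Longrightarrow> g i \<bullet> g j = 0"
    "\<And>i j. i \<le> j \<Longrightarrow> j < rank M \<Longrightarrow> g i \<bullet> g i \<le> g j \<bullet> g j"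
proof -
  obtain P where P: "linear P" "\<And>v. P v \<in> V" "\<And>v x. x \<in> V \<Longrightarrow> (v - P v) \<bullet> x = 0"
    using exists_orthogonal_projection[OF V] by blast
  let ?W = "range (\<lambda>x. M *v x)"
  have subW: "subspace ?W"
    by (intro linear_subspace_image subspace_UNIV) simp
  define R where "R = (\<lambda>u. M *v u - P (M *v u))"
  have linR: "linear R"
    unfolding R_def using linear_compose[of "\<lambda>u. M *v u" P] P(1)
    by (intro linear_compose_sub) (auto simp: o_def)
  let ?a = "\<lambda>u v. u \<bullet> (M *v v)" and ?b = "\<lambda>u v. R u \<bullet> R v"
  have a: "bilinear ?a" by (rule bilinear_inner_linear) (auto intro: linear_id[unfolded id_def])
  have b: "bilinear ?b" by (rule bilinear_inner_linear[OF linR linR])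
  \<comment> \<open>The form of \<open>M\<close> is definite on the range of \<open>M\<close>: a
    null vector \<open>x = M y\<close> lies in the kernel, whence
    \<open>x \<bullet> x = y \<bullet> M x = 0\<close>.\<close>
  have pos: "\<forall>x\<in>?W. x \<noteq> 0 \<longrightarrow> 0 < x \<bullet> (M *v x)"
  proof (intro ballI impI, rule ccontr)
    fix x assume "x \<in> ?W" "x \<noteq> 0"
    assume "\<not> 0 < x \<bullet> (M *v x)"
    moreover have "0 \<le> x \<bullet> (M *v x)" using psd by (simp add: psd_def)
    ultimately have "x \<bullet> (M *v x) = 0" by simp
    then have 0: "M *v x = 0" by (rule psd_kernel[OF psd])
    obtain y where y: "x = M *v y" using \<open>x \<in> ?W\<close> by auto
    have "x \<bullet> x = y \<bullet> (M *v x)" using psd_inner_commute[OF psd, of x y] y by simp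
    then show False using 0 \<open>x \<noteq> 0\<close> by simp
  qed
  note diag = simultaneous_diagonalization[OF a psd_inner_commute[OF psd] b inner_commute subW
      rank_dim_range[symmetric] pos]
  then obtain w where w: "\<forall>i<rank M. w i \<in> ?W"
    "\<forall>i<rank M. \<forall>j<rank M. ?a (w i) (w j) = (if i = j then 1 else 0)"
    "\<forall>i<rank M. \<forall>j<rank M. i \<noteq> j \<longrightarrow> ?b (w i) (w j) = 0"
    "\<forall>i j. i \<le> j \<longrightarrow> j < rank M \<longrightarrow> ?b (w i) (w i) \<le> ?b (w j) (w j)"
    "\<forall>x\<in>?W. x = (\<Sum>i<rank M. ?a (w i) x *\<^sub>R w i)"
    by (elim exE conjE) (rule that; assumption)
  let ?z = "\<lambda>i. M *v w i"
  \<comment> \<open>The \<open>w i\<close> are an \<open>M\<close>-orthonormal basis of the range,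
    so applying \<open>M\<close> to the expansion of a range vector gives the sum of rank one terms.
    A general \<open>v\<close> may be replaced by its projection onto the range, since
    \<open>M\<close> kills the remainder.\<close>
  have M: "M = (\<Sum>i<rank M. outer (?z i) (?z i))"
  proof -
    have mv: "(\<Sum>i<rank M. outer (?z i) (?z i)) *v v = (\<Sum>i<rank M. (?z i \<bullet> v) *\<^sub>R ?z i)" for v
    proof -
      have "(\<Sum>i\<in>I. outer (?z i) (?z i)) *v v = (\<Sum>i\<in>I. (?z i \<bullet> v) *\<^sub>R ?z i)" if "finite I" for I
        using that by induction (simp_all add: matrix_vector_mult_add_rdistrib outer_vector_mult)
      then show ?thesis by simp
    qed
    obtain PW where PW: "linear PW" "\<And>v. PW v \<in> ?W" "\<And>v x. x \<in> ?W \<Longrightarrow> (v - PW v) \<bullet> x = 0"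
      using exists_orthogonal_projection[OF subW] by blast
    have Mv: "M *v v = (\<Sum>i<rank M. (?z i \<bullet> v) *\<^sub>R ?z i)" for v
    proof -
      let ?x = "PW v" and ?y = "v - PW v"
      have "M *v (M *v ?y) \<in> ?W" by simp
      from PW(3)[OF this] have "(M *v ?y) \<bullet> (M *v ?y) = 0"
        using psd_inner_commute[OF psd, of "M *v ?y" ?y] by simp
      then have "M *v v = M *v ?x" by (simp add: matrix_vector_mult_diff_distrib)
      also have "\<dots> = M *v (\<Sum>i<rank M. ?a (w i) ?x *\<^sub>R w i)"
        using w(5) PW(2)[of v] by (intro arg_cong[of _ _ "\<lambda>x. M *v x"]) blast
      also have "\<dots> = (\<Sum>i<rank M. (w i \<bullet> (M *v ?x)) *\<^sub>R ?z i)"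
        by (simp add: linear_sum[OF matrix_vector_mul_linear] matrix_vector_mult_scaleR)
      also have "\<dots> = (\<Sum>i<rank M. (?z i \<bullet> v) *\<^sub>R ?z i)"
      proof (rule sum.cong[OF refl])
        fix i
        have "?y \<bullet> ?z i = 0" by (rule PW(3)) simp
        then have "?z i \<bullet> v = ?x \<bullet> ?z i"
          using inner_commute[of "?z i" v] by (simp add: inner_diff_left)
        then show "(w i \<bullet> (M *v ?x)) *\<^sub>R ?z i = (?z i \<bullet> v) *\<^sub>R ?z i"
          using psd_inner_commute[OF psd, of "w i" ?x] by simp
      qed
      finally show ?thesis .
    qed
    show ?thesis unfolding matrix_eq mv by (rule allI) (rule Mv)
  qed
  \<comment> \<open>With \<open>p i = P (M w i)\<close> and \<open>g i = R (w i)\<close>,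
    orthogonality and ordering of the \<open>g i\<close> are the diagonality and ordering of the
    second form.\<close>
  have PR: "P (?z i) + R (w i) = ?z i" for i by (simp add: R_def)
  show ?thesis
  proof (rule that[of "\<lambda>i. P (?z i)" "\<lambda>i. R (w i)"])
    show "M = (\<Sum>i<rank M. outer (P (?z i) + R (w i)) (P (?z i) + R (w i)))"
      unfolding PR by (rule M)
    show "P (?z i) + R (w i) \<in> ?W" for i unfolding PR by simp
    show "R (w i) \<bullet> x = 0" if "x \<in> V" for i x using P(3)[OF that] by (simp add: R_def)
  qed (use P(2) w(3,4) in auto)
qed

section \<open>Scalar inequalities behind the threshold\<close>

text \<open>\<open>T\<close> is the share of one index in the lower bound minus the upper bound for
  the residual. For \<open>\<tau> \<le> d\<close>, completing the square shows the worst case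
  \<open>d = \<tau> / (1 - \<delta>)\<close>, with
  \<open>(1 - \<delta>) T = (1 - 2 \<delta>) \<tau>^2\<close>. This changes sign at
  \<open>\<delta> = 1/2\<close>, hence the two regimes.\<close>

lemma scalar_term_bound:
  fixes \<delta> \<tau> d :: real
  assumes "0 < \<delta>" "\<delta> < 1" "0 < \<tau>" "0 \<le> d"
  defines "y \<equiv> min \<tau> d"
  defines "T \<equiv> (1 - \<delta>) * (2 * \<tau> * y - y^2) + (1 - \<delta>) * \<delta>^2 * d^2 - 2 * \<delta>^2 * \<tau> * d"
  shows "1 / 2 \<le> \<delta> \<Longrightarrow> (1 - 2 * \<delta>) * \<tau>^2 \<le> (1 - \<delta>) * T"
    and "\<delta> < 1 / 2 \<Longrightarrow> 0 \<le> T \<and> (0 < d \<longrightarrow> 0 < T)"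
proof -
  have large: "(1 - \<delta>) * T = (1 - 2 * \<delta>) * \<tau>^2 + \<delta>^2 * ((1 - \<delta>) * d - \<tau>)^2" if "\<tau> \<le> d"
    using that by (simp add: T_def y_def min_def power2_eq_square) (auto simp: algebra_simps)
  have small: "T = d * (2 * (1 - \<delta> - \<delta>^2) * (\<tau> - d) + (1 - \<delta> - \<delta>^2 - \<delta>^3) * d)" if "d \<le> \<tau>"
    using that by (cases "d = \<tau>")
      (simp_all add: T_def y_def min_def power2_eq_square power3_eq_cube algebra_simps)
  show "0 \<le> T \<and> (0 < d \<longrightarrow> 0 < T)" if \<delta>: "\<delta> < 1 / 2"
  proof (cases "d \<le> \<tau>")
    case True
    have 1: "\<delta>^2 < 1 / 4" using \<delta> assms power_strict_mono[of \<delta> "1/2" 2] by (simp add: power2_eq_square)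
    have 2: "\<delta>^3 < 1 / 8" using \<delta> assms power_strict_mono[of \<delta> "1/2" 3] by (simp add: power3_eq_cube)
    have "0 < (1 - \<delta> - \<delta>^2 - \<delta>^3) * d" if "0 < d" using that 1 2 \<delta> by simp
    moreover have "0 \<le> 2 * (1 - \<delta> - \<delta>^2) * (\<tau> - d)" using True 1 \<delta> by simp
    ultimately show ?thesis using small[OF True] assms(4)
      by (cases "d = 0") (auto intro!: mult_pos_pos less_imp_le)
  next
    case False
    then have "0 < (1 - 2 * \<delta>) * \<tau>^2" using \<delta> assms by simp
    then have "0 < (1 - \<delta>) * T" using large False by (simp add: add_pos_nonneg)
    then show ?thesis using assms by (simp add: zero_less_mult_iff)
  qed
  show "(1 - 2 * \<delta>) * \<tau>^2 \<le> (1 - \<delta>) * T" if \<delta>: "1 / 2 \<le> \<delta>"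
  proof (cases "d \<le> \<tau>")
    case False
    then show ?thesis using large by simp
  next
    case True
    have "(1 - \<delta>) * T - (1 - 2 * \<delta>) * \<tau>^2 = (2 * \<delta> - 1) * (\<tau> - d)^2 + 2 * \<delta>^3 * d * (\<tau> - d) + \<delta>^4 * d^2"
      unfolding small[OF True] by (simp add: power2_eq_square power3_eq_cube power4_eq_xxxx algebra_simps)
    moreover have "0 \<le> (2 * \<delta> - 1) * (\<tau> - d)^2 + 2 * \<delta>^3 * d * (\<tau> - d) + \<delta>^4 * d^2"
      using True \<delta> assms by (intro add_nonneg_nonneg mult_nonneg_nonneg) auto
    ultimately show ?thesis by linarith
  qed
qed

text \<open>Here \<open>c\<close> stands for \<open>|T|^2\<close> of the residual and
  \<open>d i\<close> for \<open>|g i|^2\<close>. Below 1/2 all summands are nonnegative with sum at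
  most 0, so they vanish. From 1/2 on, a summand may be negative, and the \<open>r - m\<close>
  surplus terms \<open>\<tau>^2\<close> have to compensate.\<close>

lemma scalar_contradiction:
  fixes d :: "nat \<Rightarrow> real" and \<delta> \<tau> c :: real
  assumes \<delta>: "0 < \<delta>" "\<delta> < 1" "\<delta> < 1 / (1 + sqrt (real m / real r))" and r: "0 < r" "m \<le> r"
    and \<tau>: "0 < \<tau>" and d: "\<And>i. i < m \<Longrightarrow> 0 \<le> d i"
    and c: "0 \<le> c" "(\<Sum>i<m. 2 * \<tau> * min \<tau> (d i) - (min \<tau> (d i))^2) + real (r - m) * \<tau>^2 \<le> c"
    and le: "(1 - \<delta>) * (c + \<delta>^2 * (\<Sum>i<m. (d i)^2)) \<le> 2 * \<delta>^2 * \<tau> * (\<Sum>i<m. d i)"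
  shows "c = 0 \<and> (\<Sum>i<m. (d i)^2) = 0"
proof -
  define T where "T = (\<lambda>i. (1 - \<delta>) * (2 * \<tau> * min \<tau> (d i) - (min \<tau> (d i))^2)
      + (1 - \<delta>) * \<delta>^2 * (d i)^2 - 2 * \<delta>^2 * \<tau> * d i)"
  have sumT: "(\<Sum>i<m. T i) = (1 - \<delta>) * (\<Sum>i<m. 2 * \<tau> * min \<tau> (d i) - (min \<tau> (d i))^2)
      + (1 - \<delta>) * \<delta>^2 * (\<Sum>i<m. (d i)^2) - 2 * \<delta>^2 * \<tau> * (\<Sum>i<m. d i)"
    by (simp add: T_def sum.distrib sum_subtractf sum_distrib_left right_diff_distrib mult.assoc)
  have "(1 - \<delta>) * ((\<Sum>i<m. 2 * \<tau> * min \<tau> (d i) - (min \<tau> (d i))^2) + real (r - m) * \<tau>^2) \<le> (1 - \<delta>) * c"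
    using c \<delta> by (intro mult_left_mono) auto
  then have main: "(\<Sum>i<m. T i) + (1 - \<delta>) * (real (r - m) * \<tau>^2) \<le> 0"
    using le unfolding sumT by (simp add: algebra_simps)
  show ?thesis
  proof (cases "\<delta> < 1 / 2")
    case True
    have T: "0 \<le> T i \<and> (0 < d i \<longrightarrow> 0 < T i)" if "i < m" for i
      unfolding T_def by (rule scalar_term_bound(2)[OF \<delta>(1,2) \<tau> d[OF that] True])
    have "0 \<le> (1 - \<delta>) * (real (r - m) * \<tau>^2)" using \<delta> by simp
    then have "(\<Sum>i<m. T i) \<le> 0" using main by linarith
    moreover have T0: "\<forall>i\<in>{..<m}. 0 \<le> T i" using T by auto
    ultimately have "(\<Sum>i<m. T i) = 0" by (intro order_antisym sum_nonneg) auto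
    then have "\<forall>i\<in>{..<m}. T i = 0" using T0 by (subst (asm) sum_nonneg_eq_0_iff) auto
    then have d0: "d i = 0" if "i < m" for i using T[OF that] d[OF that] that by force
    then have "(1 - \<delta>) * c \<le> 0" using le by simp
    then show ?thesis using d0 c(1) \<delta> by (simp add: mult_le_0_iff)
  next
    case False
    let ?\<rho> = "sqrt (real m / real r)"
    have "\<delta> + \<delta> * ?\<rho> < 1" using \<delta>(3) by (simp add: less_divide_eq add_pos_nonneg algebra_simps)
    then have "\<delta> * ?\<rho> < 1 - \<delta>" by simp
    then have "(\<delta> * ?\<rho>)^2 < (1 - \<delta>)^2" using \<delta> by (intro power_strict_mono) auto
    \<comment> \<open>This squared form of the threshold is exactly positivity of the total
      coefficient \<open>m (1 - 2 \<delta>) + (1 - \<delta>)^2 (r - m)\<close> of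
      \<open>\<tau>^2\<close>.\<close>
    then have thr: "\<delta>^2 * real m < (1 - \<delta>)^2 * real r"
      using r by (simp add: power_mult_distrib divide_simps)
    have "real m * ((1 - 2 * \<delta>) * \<tau>^2) \<le> (\<Sum>i<m. (1 - \<delta>) * T i)"
      using sum_mono[of "{..<m}" "\<lambda>_. (1 - 2 * \<delta>) * \<tau>^2" "\<lambda>i. (1 - \<delta>) * T i"]
        scalar_term_bound(1)[OF \<delta>(1,2) \<tau> d] False by (simp add: T_def)
    then have "real m * ((1 - 2 * \<delta>) * \<tau>^2) + (1 - \<delta>)^2 * (real (r - m) * \<tau>^2) \<le>
        (1 - \<delta>) * ((\<Sum>i<m. T i) + (1 - \<delta>) * (real (r - m) * \<tau>^2))"
      by (simp add: sum_distrib_left power2_eq_square algebra_simps)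
    also have "\<dots> \<le> 0" using main \<delta> by (simp add: mult_le_0_iff)
    finally have "((1 - \<delta>)^2 * real r - \<delta>^2 * real m) * \<tau>^2 \<le> 0"
      using r by (simp add: of_nat_diff power2_eq_square algebra_simps)
    then show ?thesis using thr \<tau> by (simp add: mult_le_0_iff)
  qed
qed

section \<open>Upper and lower bounds for the residual\<close>

text \<open>Stationarity gives \<open>B T T = B G T\<close>, so all values of \<open>B\<close>
  involved reduce to \<open>u = B T G\<close> and \<open>v = B G G\<close>. Since \<open>T\<close>
  and \<open>G\<close> are orthogonal, both test matrices have the same norm.\<close>

lemma rip_cross_bound:
  fixes B :: "'a::real_inner \<Rightarrow> 'a \<Rightarrow> real"
  assumes B: "bilinear B" "\<And>x y. B x y = B y x" and \<delta>: "0 < \<delta>"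
    and orth: "T \<bullet> G = 0"
    and rip: "(1 - \<delta>) * (norm (T - \<delta> *\<^sub>R G))^2 \<le> B (T - \<delta> *\<^sub>R G) (T - \<delta> *\<^sub>R G)"
      "B (T + \<delta> *\<^sub>R G) (T + \<delta> *\<^sub>R G) \<le> (1 + \<delta>) * (norm (T + \<delta> *\<^sub>R G))^2"
    and first: "B (T - G) T = 0" and second: "- ((1 + \<delta>) * \<beta>) \<le> B (T - G) G"
  shows "(1 - \<delta>) * ((norm T)^2 + \<delta>^2 * (norm G)^2) \<le> 2 * \<delta>^2 * \<beta>"
proof -
  define N where "N = (norm T)^2 + \<delta>^2 * (norm G)^2"
  have norms: "(norm (T + \<delta> *\<^sub>R G))^2 = N" "(norm (T - \<delta> *\<^sub>R G))^2 = N"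
    using orth inner_commute[of G T]
    by (simp_all add: N_def power2_norm_eq_inner inner_add_left inner_add_right inner_diff_left
        inner_diff_right) (simp_all add: power2_eq_square)
  note expand = bilinear_ladd[OF B(1)] bilinear_radd[OF B(1)] bilinear_lsub[OF B(1)]
    bilinear_rsub[OF B(1)] bilinear_lmul[OF B(1)] bilinear_rmul[OF B(1)]
  define u v where "u = B T G" and "v = B G G"
  have f: "B T T = u" "B G T = u" using first B(2)[of G T] by (simp_all add: expand u_def)
  have s: "v - u \<le> (1 + \<delta>) * \<beta>" using second by (simp add: expand u_def v_def)
  have lo: "(1 - \<delta>) * N \<le> (1 - 2 * \<delta>) * u + \<delta>^2 * v"
    using rip(1) unfolding norms
    by (simp add: expand f u_def[symmetric] v_def[symmetric] power2_eq_square algebra_simps)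
  have hi: "(1 + 2 * \<delta>) * u + \<delta>^2 * v \<le> (1 + \<delta>) * N"
    using rip(2) unfolding norms
    by (simp add: expand f u_def[symmetric] v_def[symmetric] power2_eq_square algebra_simps)
  \<comment> \<open>The weights \<open>(1 + \<delta>)^2\<close> and \<open>(1 - \<delta>)^2\<close>
    make the coefficients of \<open>u\<close> and \<open>v\<close> opposite, namely
    \<open>\<minusplus> 4 \<delta>^3\<close>; only \<open>v - u\<close> is left, which
    \<open>second\<close> bounds.\<close>
  have "(1 + \<delta>)^2 * ((1 - \<delta>) * N) + (1 - \<delta>)^2 * ((1 + 2 * \<delta>) * u + \<delta>^2 * v)
      \<le> (1 + \<delta>)^2 * ((1 - 2 * \<delta>) * u + \<delta>^2 * v) + (1 - \<delta>)^2 * ((1 + \<delta>) * N)"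
    by (intro add_mono mult_left_mono lo hi) auto
  then have "2 * \<delta> * (1 + \<delta>) * ((1 - \<delta>) * N) \<le> 4 * \<delta>^3 * (v - u)"
    by (simp add: power2_eq_square power3_eq_cube algebra_simps)
  also have "\<dots> \<le> 4 * \<delta>^3 * ((1 + \<delta>) * \<beta>)"
    using \<delta> s by (intro mult_left_mono) auto
  also have "\<dots> = 2 * \<delta> * (1 + \<delta>) * (2 * \<delta>^2 * \<beta>)"
    by (simp add: power2_eq_square power3_eq_cube)
  finally show ?thesis
    unfolding N_def by (rule mult_left_le_imp_le) (use \<delta> in simp)
qed

text \<open>By Bessel it suffices to bound the diagonal entries \<open>x j - k j\<close> of the
  matrix in an orthonormal basis \<open>e\<close> of the range of \<open>X\<close>. The flag
  property means that \<open>e j\<close> sees only those \<open>p i\<close> with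
  \<open>i \<ge> j\<close>; as \<open>d\<close> is ascending, their weights \<open>d i\<close> are
  at least \<open>d j\<close>.\<close>

lemma norm_residual_lower_bound:
  fixes X :: "real^'r^'n" and p :: "nat \<Rightarrow> real^'n" and d :: "nat \<Rightarrow> real"
  assumes m: "m \<le> CARD('r)" and \<tau>: "0 < \<tau>" "\<And>y. \<tau> * (norm y)^2 \<le> (norm (X *v y))^2"
    and d: "\<And>i. i < m \<Longrightarrow> 0 \<le> d i" "\<And>i j. i \<le> j \<Longrightarrow> j < m \<Longrightarrow> d i \<le> d j"
  shows "(\<Sum>i<m. 2 * \<tau> * min \<tau> (d i) - (min \<tau> (d i))^2) + real (CARD('r) - m) * \<tau>^2 \<le>
    (norm (X ** transpose X - (\<Sum>i<m. outer (p i) (p i))))^2 + 2 * (\<Sum>i<m. d i * (norm (p i))^2)"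
proof -
  define V where "V = range (\<lambda>y. X *v y)"
  have V: "subspace V" unfolding V_def by (intro linear_subspace_image subspace_UNIV) simp
  have "inj (\<lambda>y. X *v y)"
  proof (rule injI)
    fix x y assume "X *v x = X *v y"
    then have "\<tau> * (norm (x - y))^2 \<le> 0" using \<tau>(2)[of "x - y"] by (simp add: matrix_vector_mult_diff_distrib)
    then show "x = y" using \<tau>(1) by (simp add: mult_le_0_iff)
  qed
  then have "dim V = CARD('r)"
    unfolding V_def by (subst dim_image_eq) (auto intro: inj_on_subset)
  from orthonormal_flag_basis[OF V this, of p]
  obtain e where e: "\<forall>j<CARD('r). e j \<in> V"
    "\<forall>i<CARD('r). \<forall>j<CARD('r). e i \<bullet> e j = (if i = j then 1 else 0)" "\<forall>j<CARD('r). \<forall>i<j. e j \<bullet> p i = 0"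
    by (elim exE conjE) (rule that; assumption)
  let ?A = "X ** transpose X - (\<Sum>i<m. outer (p i) (p i))"
  define k where "k = (\<lambda>j. \<Sum>i<m. (p i \<bullet> e j)^2)"
  define x where "x = (\<lambda>j. (norm (transpose X *v e j))^2)"
  have Ae: "?A \<bullet> outer (e j) (e j) = x j - k j" for j
  proof -
    have "(X ** transpose X) \<bullet> outer (e j) (e j) = e j \<bullet> (X *v (transpose X *v e j))"
      by (subst inner_commute) (simp add: inner_outer_left matrix_vector_mul_assoc del: transpose_matrix_vector)
    also have "\<dots> = x j"
      by (simp add: x_def power2_norm_eq_inner flip: dot_lmul_matrix)
    finally show ?thesis
      by (simp add: inner_diff_left inner_sum_left inner_outer_outer k_def power2_eq_square)
  qed
  \<comment> \<open>If \<open>e j = X y\<close>, then \<open>|y|^2 \<le> 1 / \<tau>\<close>, while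
    Cauchy-Schwarz gives \<open>1 = (transpose X e j) \<bullet> y \<le> |transpose X e j|
    |y|\<close>.\<close>
  have x: "\<tau> \<le> x j" if "j < CARD('r)" for j
  proof -
    obtain y where y: "e j = X *v y" using e(1) \<open>j < _\<close> by (auto simp: V_def)
    have ee: "e j \<bullet> e j = 1" using e(2) that by simp
    then have "1 = e j \<bullet> (X *v y)" unfolding y[symmetric] by simp
    also have "\<dots> = (transpose X *v e j) \<bullet> y" by (simp add: dot_lmul_matrix)
    also have "\<dots> \<le> norm (transpose X *v e j) * norm y" by (rule norm_cauchy_schwarz)
    finally have "1\<^sup>2 \<le> (norm (transpose X *v e j) * norm y)\<^sup>2" by (intro power_mono) auto
    then have 1: "1 \<le> x j * (norm y)^2" by (simp add: x_def power_mult_distrib)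
    have "\<tau> * (norm y)^2 \<le> 1" using \<tau>(2)[of y] ee unfolding y[symmetric] power2_norm_eq_inner by simp
    then have "\<tau> * (norm y)^2 \<le> x j * (norm y)^2" using 1 by simp
    moreover have "y \<noteq> 0" using 1 by auto
    ultimately show ?thesis by simp
  qed
  have k0: "0 \<le> k j" for j by (simp add: k_def sum_nonneg)
  \<comment> \<open>The default 0 covers the indices from \<open>m\<close> on, where the flag
    property forces \<open>k j = 0\<close>.\<close>
  let ?d = "\<lambda>j. if j < m then d j else 0"
  have "(\<Sum>j<CARD('r). ?d j * k j) \<le> (\<Sum>j<CARD('r). \<Sum>i<m. d i * (p i \<bullet> e j)^2)"
  proof (rule sum_mono)
    fix j assume j: "j \<in> {..<CARD('r)}"
    show "?d j * k j \<le> (\<Sum>i<m. d i * (p i \<bullet> e j)^2)"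
      unfolding k_def sum_distrib_left
    proof (rule sum_mono)
      fix i assume i: "i \<in> {..<m}"
      show "?d j * (p i \<bullet> e j)^2 \<le> d i * (p i \<bullet> e j)^2"
      proof (cases "i < j")
        case True
        then have "p i \<bullet> e j = 0" using e(3) j by (simp add: inner_commute)
        then show ?thesis by simp
      next
        case False
        then have "?d j \<le> d i" using d i by auto
        then show ?thesis by (rule mult_right_mono) simp
      qed
    qed
  qed
  also have "\<dots> = (\<Sum>i<m. d i * (\<Sum>j<CARD('r). (p i \<bullet> e j)^2))"
    by (subst sum.swap) (simp add: sum_distrib_left)
  also have "\<dots> \<le> (\<Sum>i<m. d i * (norm (p i))^2)"
    by (intro sum_mono mult_left_mono bessel_inequality) (use e(2) d in auto)
  finally have kd: "(\<Sum>j<CARD('r). ?d j * k j) \<le> (\<Sum>i<m. d i * (norm (p i))^2)" .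
  have "(\<Sum>j<CARD('r). (x j - k j)^2) = (\<Sum>j<CARD('r). (?A \<bullet> outer (e j) (e j))^2)"
    by (simp add: Ae)
  also have "\<dots> \<le> (norm ?A)^2"
    by (rule bessel_inequality) (use e(2) in \<open>auto simp: inner_outer_outer\<close>)
  finally have A: "(\<Sum>j<CARD('r). (x j - k j)^2) \<le> (norm ?A)^2" .
  let ?f = "\<lambda>j. if j < m then 2 * \<tau> * min \<tau> (d j) - (min \<tau> (d j))^2 else \<tau>^2"
  have "(\<Sum>j<CARD('r). ?f j) \<le> (\<Sum>j<CARD('r). (x j - k j)^2 + 2 * (?d j * k j))"
  proof (rule sum_mono)
    fix j assume j: "j \<in> {..<CARD('r)}"
    show "?f j \<le> (x j - k j)^2 + 2 * (?d j * k j)"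
    proof (cases "j < m")
      case True
      define y where "y = min \<tau> (d j)"
      have y: "0 \<le> y" "y \<le> d j" using True d \<tau> by (auto simp: y_def)
      \<comment> \<open>The three terms add up to
        \<open>(x j - k j)^2 + 2 d j k j - (2 \<tau> y - y^2)\<close>.\<close>
      have "0 \<le> (x j - k j - y)^2 + 2 * y * (x j - \<tau>) + 2 * (d j - y) * k j"
        using y x[of j] j k0[of j] by (intro add_nonneg_nonneg mult_nonneg_nonneg) auto
      then show ?thesis using True by (simp add: y_def[symmetric] power2_eq_square algebra_simps)
    next
      case False
      then have "k j = 0" using e(3) j by (simp add: k_def inner_commute)
      then show ?thesis using False x[of j] j \<tau> by (simp add: power_mono)
    qed
  qed
  also have "\<dots> = (\<Sum>j<CARD('r). (x j - k j)^2) + 2 * (\<Sum>j<CARD('r). ?d j * k j)"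
    by (simp only: sum.distrib sum_distrib_left)
  also have "\<dots> \<le> (norm ?A)^2 + 2 * (\<Sum>i<m. d i * (norm (p i))^2)"
    using A kd by linarith
  finally have "(\<Sum>j<CARD('r). ?f j) \<le> (norm ?A)^2 + 2 * (\<Sum>i<m. d i * (norm (p i))^2)" .
  moreover have "(\<Sum>j<CARD('r). ?f j) = (\<Sum>i<m. ?f i) + (\<Sum>i=m..<CARD('r). ?f i)"
    using sum.atLeastLessThan_concat[OF le0 m, of ?f] by (simp only: atLeast0LessThan)
  moreover have "(\<Sum>i<m. ?f i) = (\<Sum>i<m. 2 * \<tau> * min \<tau> (d i) - (min \<tau> (d i))^2)"
    by (rule sum.cong) auto
  moreover have "(\<Sum>i=m..<CARD('r). ?f i) = real (CARD('r) - m) * \<tau>^2"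
    by simp
  ultimately show ?thesis by linarith
qed

section \<open>Exclusion of spurious second order points\<close>

text \<open>The form \<open>B\<close> is already divided by the scaling factor; \<open>first\<close>
  and \<open>second\<close> are the conditions on gradient and Hessian of the objective, each
  divided by 2.\<close>

lemma no_spurious_second_order_point:
  fixes B :: "real^'n^'n \<Rightarrow> real^'n^'n \<Rightarrow> real" and X :: "real^'r^'n" and M :: "real^'n^'n"
  assumes B: "bilinear B" "\<And>x y. B x y = B y x"
    and M: "psd M" "rank M \<le> CARD('r)"
    and \<delta>: "0 < \<delta>" "\<delta> < 1" "\<delta> < 1 / (1 + sqrt (real (rank M) / real CARD('r)))"
    and rip: "\<And>F. rank F \<le> CARD('r) + rank M \<Longrightarrow>
      (1 - \<delta>) * (norm F)^2 \<le> B F F \<and> B F F \<le> (1 + \<delta>) * (norm F)^2"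
    and first: "\<And>V. B (X ** transpose X - M) (X ** transpose V + V ** transpose X) = 0"
    and second: "\<And>V. 0 \<le> B (X ** transpose V + V ** transpose X) (X ** transpose V + V ** transpose X)
      + 2 * B (X ** transpose X - M) (V ** transpose V)"
  shows "X ** transpose X = M"
proof -
  define V where "V = range (\<lambda>y. X *v y)"
  have V: "subspace V" unfolding V_def by (intro linear_subspace_image subspace_UNIV) simp
  let ?W = "range (\<lambda>x. M *v x)" and ?m = "rank M"
  have W: "subspace ?W" by (intro linear_subspace_image subspace_UNIV) simp
  obtain p g where Mpg: "M = (\<Sum>i<?m. outer (p i + g i) (p i + g i))"
    and p: "\<And>i. p i \<in> V" and g: "\<And>i x. x \<in> V \<Longrightarrow> g i \<bullet> x = 0"
    and pg: "\<And>i. p i + g i \<in> ?W"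
    and gg: "\<And>i j. i < ?m \<Longrightarrow> j < ?m \<Longrightarrow> i \<noteq> j \<Longrightarrow> g i \<bullet> g j = 0"
    and mono: "\<And>i j. i \<le> j \<Longrightarrow> j < ?m \<Longrightarrow> g i \<bullet> g i \<le> g j \<bullet> g j"
    by (rule psd_adapted_decomposition[OF M(1) V]) (rule that; (assumption | blast))
  define d where "d = (\<lambda>i. g i \<bullet> g i)"
  \<comment> \<open>\<open>A\<close> is the block of \<open>E\<close> on the range of
    \<open>X\<close>, \<open>- C\<close> collects the mixed terms and \<open>- G\<close> is the
    block outside. The three are pairwise Frobenius orthogonal.\<close>
  define G where "G = (\<Sum>i<?m. outer (g i) (g i))"
  define C where "C = (\<Sum>i<?m. outer (p i) (g i) + outer (g i) (p i))"
  define A where "A = X ** transpose X - (\<Sum>i<?m. outer (p i) (p i))"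
  define T where "T = A - C"
  have E: "X ** transpose X - M = T - G"
    by (subst Mpg) (simp add: T_def A_def C_def G_def outer_add_left outer_add_right sum.distrib algebra_simps)

  \<comment> \<open>All matrices to be tested map into \<open>U\<close>, of dimension at most
    \<open>CARD('r) + rank M\<close>. Such matrices form a subspace \<open>K\<close>, so the
    isometry bounds hold for all their linear combinations.\<close>
  define U where "U = {x + y |x y. x \<in> V \<and> y \<in> ?W}"
  have U: "subspace U" unfolding U_def by (rule subspace_sums[OF V W])
  have "dim V \<le> CARD('r)"
    unfolding V_def using dim_image_le[of "\<lambda>y. X *v y" UNIV] by simp
  moreover have "dim U + dim (V \<inter> ?W) = dim V + dim ?W"
    unfolding U_def by (rule dim_sums_Int[OF V W])
  ultimately have dimU: "dim U \<le> CARD('r) + ?m" by (simp add: rank_dim_range)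
  define K where "K = {F :: real^'n^'n. \<forall>x. F *v x \<in> U}"
  have K: "subspace K"
    using U by (auto simp: K_def subspace_def matrix_vector_mult_add_rdistrib scaleR_matrix_vector_assoc[symmetric])
  have ripK: "(1 - \<delta>) * (norm F)^2 \<le> B F F" "B F F \<le> (1 + \<delta>) * (norm F)^2" if "F \<in> K" for F
  proof -
    have "rank F \<le> dim U" by (rule rank_le_dim_if_range_subset) (use that in \<open>auto simp: K_def\<close>)
    then have "rank F \<le> CARD('r) + ?m" using dimU by simp
    then show "(1 - \<delta>) * (norm F)^2 \<le> B F F" "B F F \<le> (1 + \<delta>) * (norm F)^2" using rip by auto
  qed
  have VU: "x \<in> U" if "x \<in> V" for x
    unfolding U_def using that subspace_0[OF W] by force
  have "p i + g i \<in> U" for i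
    unfolding U_def using pg[of i] subspace_0[OF V] by force
  then have gU: "g i \<in> U" for i
    using subspace_diff[OF U, of "p i + g i" "p i"] VU[OF p] by simp
  have outerK: "outer a b \<in> K" if "a \<in> U" for a b
    using that U by (simp add: K_def outer_vector_mult subspace_scale)
  have "X ** transpose X \<in> K"
    unfolding K_def using VU by (simp add: V_def flip: matrix_vector_mul_assoc)
  then have AK: "A \<in> K"
    unfolding A_def by (intro subspace_diff[OF K] subspace_sum[OF K] outerK VU p)
  have GK: "G \<in> K" unfolding G_def by (intro subspace_sum[OF K] outerK gU)
  have "C \<in> K"
    unfolding C_def by (intro subspace_sum[OF K] subspace_add[OF K] outerK gU VU p)
  then have TK: "T \<in> K" unfolding T_def by (intro subspace_diff[OF K] AK)

  have gp: "g i \<bullet> p j = 0" "p j \<bullet> g i = 0" for i j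
    using g[OF p] by (simp_all add: inner_commute)
  have Xg: "transpose X *v g i = 0" for i
  proof -
    have "(transpose X *v g i) \<bullet> y = 0" for y
      using g[of "X *v y" i] by (simp add: V_def dot_lmul_matrix)
    then show ?thesis by (metis inner_eq_zero_iff)
  qed
  have XXg: "(X ** transpose X) *v g i = 0" for i
    unfolding matrix_vector_mul_assoc[symmetric] Xg by simp
  have gXX: "g i \<bullet> ((X ** transpose X) *v y) = 0" for i y
    unfolding matrix_vector_mul_assoc[symmetric] by (rule g) (simp add: V_def)
  have GA: "G \<bullet> A = 0"
    by (simp add: G_def A_def inner_diff_right inner_sum_left inner_sum_right inner_outer_outer gp)
      (simp add: inner_outer_left gXX)
  have GC: "G \<bullet> C = 0"
    by (simp add: G_def C_def inner_sum_left inner_sum_right inner_add_right inner_outer_outer gp)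
  have CA: "C \<bullet> A = 0"
    by (simp add: C_def A_def inner_diff_right inner_sum_left inner_sum_right inner_add_left
        inner_outer_outer gp) (simp add: inner_outer_left gXX XXg)
  have TG: "T \<bullet> G = 0"
    using GA GC by (simp add: T_def inner_diff_right inner_commute[of _ G])
  have G2: "(norm G)^2 = (\<Sum>i<?m. (d i)^2)"
  proof -
    have "(\<Sum>j<?m. (g j \<bullet> g i)^2) = (d i)^2" if "i < ?m" for i
    proof -
      have "(\<Sum>j<?m. (g j \<bullet> g i)^2) = (\<Sum>j<?m. if j = i then (d i)^2 else 0)"
        by (rule sum.cong) (use gg that in \<open>auto simp: d_def\<close>)
      then show ?thesis using that by simp
    qed
    then show ?thesis
      by (simp add: G_def power2_norm_eq_inner inner_sum_left inner_sum_right inner_outer_outer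
          flip: power2_eq_square)
  qed
  have C2: "(norm C)^2 = 2 * (\<Sum>i<?m. d i * (norm (p i))^2)"
  proof -
    have "(\<Sum>j<?m. 2 * ((p j \<bullet> p i) * (g j \<bullet> g i))) = 2 * (d i * (norm (p i))^2)" if "i < ?m" for i
    proof -
      have "(\<Sum>j<?m. 2 * ((p j \<bullet> p i) * (g j \<bullet> g i))) = (\<Sum>j<?m. if j = i then 2 * (d i * (norm (p i))^2) else 0)"
        by (rule sum.cong) (use gg that in \<open>auto simp: d_def power2_norm_eq_inner\<close>)
      then show ?thesis using that by simp
    qed
    then show ?thesis
      by (simp add: C_def power2_norm_eq_inner inner_sum_left inner_sum_right inner_add_left
          inner_add_right inner_outer_outer gp sum_distrib_left mult.commute)
  qed
  have T2: "(norm T)^2 = (norm A)^2 + (norm C)^2"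
    using CA by (simp add: T_def power2_norm_eq_inner inner_diff_left inner_diff_right inner_commute[of A C])

  have "continuous_on (sphere 0 1) (\<lambda>y. norm (X *v y))"
    by (intro continuous_intros linear_continuous_on_compose[of _ id, simplified]) auto
  moreover have "sphere (0::real^'r) 1 \<noteq> {}" by simp
  ultimately obtain u where u: "u \<in> sphere 0 1" "\<And>y. y \<in> sphere 0 1 \<Longrightarrow> norm (X *v u) \<le> norm (X *v y)"
    using continuous_attains_inf[OF compact_sphere, of 0 1 "\<lambda>y. norm (X *v y)"] by blast
  define \<tau> where "\<tau> = (norm (X *v u))^2"
  have \<tau>: "\<tau> * (norm y)^2 \<le> (norm (X *v y))^2" for y
  proof (cases "y = 0")
    case False
    have "norm (X *v u) \<le> norm (X *v (y /\<^sub>R norm y))" using False by (intro u(2)) simp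
    then have "norm (X *v u) * norm y \<le> norm (X *v y)"
      using False by (simp add: matrix_vector_mult_scaleR divide_simps)
    then have "(norm (X *v u) * norm y)^2 \<le> (norm (X *v y))^2" by (intro power_mono) auto
    then show ?thesis by (simp add: \<tau>_def power_mult_distrib)
  qed simp

  define L where "L = B (T - G)"
  have L: "linear L" using B(1) unfolding L_def bilinear_def by blast
  have first': "L (X ** transpose V + V ** transpose X) = 0" for V
    using first[of V] unfolding E L_def .
  have LX: "L (X ** transpose X) = 0" using first'[of X] unfolding linear_add[OF L] by simp
  \<comment> \<open>Taking \<open>V = outer v y\<close> with \<open>x = X y\<close> shows that every
    symmetrised outer product with one factor in the range of \<open>X\<close> is a tangent
    direction.\<close>
  have Lout: "L (outer x v + outer v x) = 0" if "x \<in> V" for x v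
  proof -
    obtain y where "x = X *v y" using \<open>x \<in> V\<close> unfolding V_def by blast
    then show ?thesis using first'[of "outer v y"] by (simp add: matrix_mult_transpose_outer outer_mult_transpose)
  qed
  have "L (outer (p i) (p i)) = 0" for i
    using Lout[OF p, of i "p i"] unfolding linear_add[OF L] by simp
  then have LT: "L T = 0"
    by (simp add: T_def A_def C_def linear_diff[OF L] linear_sum[OF L] LX Lout p)
  \<comment> \<open>The Hessian direction is \<open>outer (g i) u\<close>. Its first order part
    \<open>?D\<close> has squared norm \<open>2 \<tau> d i\<close> because \<open>g i\<close> is
    orthogonal to \<open>X u\<close>, and its second order part is \<open>outer (g i) (g i)\<close>
    because \<open>u\<close> is a unit vector.\<close>
  have Lg: "- ((1 + \<delta>) * (\<tau> * d i)) \<le> L (outer (g i) (g i))" for i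
  proof -
    let ?D = "outer (X *v u) (g i) + outer (g i) (X *v u)"
    have "u \<bullet> u = 1" using u(1) by (simp add: norm_eq_1)
    then have "0 \<le> B ?D ?D + 2 * L (outer (g i) (g i))"
      using second[of "outer (g i) u"] unfolding E outer_mult_transpose_outer
      by (simp add: L_def matrix_mult_transpose_outer outer_mult_transpose)
    moreover have "?D \<in> K"
      by (intro subspace_add[OF K] outerK gU VU) (simp add: V_def)
    then have "B ?D ?D \<le> (1 + \<delta>) * (norm ?D)^2" by (rule ripK)
    moreover have "(norm ?D)^2 = 2 * (\<tau> * d i)"
      using g[of "X *v u" i] by (simp add: V_def power2_norm_eq_inner inner_add_left inner_add_right
          inner_outer_outer d_def \<tau>_def inner_commute)
    ultimately show ?thesis by simp
  qed
  have "- ((1 + \<delta>) * (\<tau> * (\<Sum>i<?m. d i))) = (\<Sum>i<?m. - ((1 + \<delta>) * (\<tau> * d i)))"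
    by (simp add: sum_distrib_left sum_negf)
  also have "\<dots> \<le> (\<Sum>i<?m. L (outer (g i) (g i)))" by (rule sum_mono) (rule Lg)
  also have "\<dots> = L G" by (simp add: G_def linear_sum[OF L])
  finally have LG: "- ((1 + \<delta>) * (\<tau> * (\<Sum>i<?m. d i))) \<le> L G" .

  have key: "(1 - \<delta>) * ((norm T)^2 + \<delta>^2 * (\<Sum>i<?m. (d i)^2)) \<le> 2 * \<delta>^2 * (\<tau> * (\<Sum>i<?m. d i))"
    unfolding G2[symmetric]
  proof (rule rip_cross_bound[OF B \<delta>(1) TG])
    have "T - \<delta> *\<^sub>R G \<in> K" "T + \<delta> *\<^sub>R G \<in> K"
      using K TK GK by (auto intro: subspace_diff subspace_add subspace_scale)
    then show "(1 - \<delta>) * (norm (T - \<delta> *\<^sub>R G))^2 \<le> B (T - \<delta> *\<^sub>R G) (T - \<delta> *\<^sub>R G)"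
      "B (T + \<delta> *\<^sub>R G) (T + \<delta> *\<^sub>R G) \<le> (1 + \<delta>) * (norm (T + \<delta> *\<^sub>R G))^2"
      by (auto intro: ripK)
    show "B (T - G) T = 0" "- ((1 + \<delta>) * (\<tau> * (\<Sum>i<?m. d i))) \<le> B (T - G) G"
      using LT LG by (simp_all add: L_def)
  qed
  have "(norm T)^2 = 0 \<and> (\<Sum>i<?m. (d i)^2) = 0"
  \<comment> \<open>For \<open>\<tau> = 0\<close>, that is for \<open>X\<close> with a nontrivial
    kernel, the right side of \<open>key\<close> vanishes and there is nothing to compare.\<close>
  proof (cases "\<tau> = 0")
    case True
    then have "(norm T)^2 + \<delta>^2 * (\<Sum>i<?m. (d i)^2) \<le> 0" using key \<delta> by (simp add: mult_le_0_iff)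
    moreover have "0 \<le> \<delta>^2 * (\<Sum>i<?m. (d i)^2)" by (simp add: sum_nonneg)
    moreover have "0 \<le> (norm T)^2" by simp
    ultimately have "(norm T)^2 = 0" "\<delta>^2 * (\<Sum>i<?m. (d i)^2) = 0" by linarith+
    then show ?thesis using \<delta> by simp
  next
    case False
    then have \<tau>0: "0 < \<tau>" by (simp add: \<tau>_def)
    have "(\<Sum>i<?m. 2 * \<tau> * min \<tau> (d i) - (min \<tau> (d i))^2) + real (CARD('r) - ?m) * \<tau>^2 \<le> (norm T)^2"
      unfolding T2 C2 A_def
      by (rule norm_residual_lower_bound[OF M(2) \<tau>0 \<tau>]) (use mono in \<open>auto simp: d_def\<close>)
    then show ?thesis
      using key by (intro scalar_contradiction[OF \<delta> _ M(2) \<tau>0]) (auto simp: d_def mult.assoc)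
  qed
  then have "T = 0" "G = 0" using G2 by auto
  then show ?thesis using E by simp
qed

section \<open>Gradient and Hessian of the factored objective\<close>

lemma bilinear_mult_transpose: "bilinear (\<lambda>(U :: real^'r^'n) (V :: real^'r^'m). U ** transpose V)"
  by (auto simp: bilinear_def linear_iff matrix_matrix_mult_def transpose_def vec_eq_iff
      distrib_left distrib_right sum.distrib sum_distrib_left mult_ac)

text \<open>Along a line \<open>X + t H\<close> the objective is a polynomial of degree four in
  \<open>t\<close>, so the Hessian form can be read off its quadratic coefficient.\<close>

lemma deriv_deriv_quartic:
  "deriv (deriv (\<lambda>t::real. a0 + t * a1 + t^2 * a2 + t^3 * a3 + t^4 * a4)) 0 = 2 * a2"
proof -
  have "deriv (\<lambda>t::real. a0 + t * a1 + t^2 * a2 + t^3 * a3 + t^4 * a4) =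
      (\<lambda>t. a1 + 2 * t * a2 + 3 * t^2 * a3 + 4 * t^3 * a4)"
    by (rule ext, rule DERIV_imp_deriv) (auto intro!: derivative_eq_intros)
  moreover have "deriv (\<lambda>t. a1 + 2 * t * a2 + 3 * t^2 * a3 + 4 * t^3 * a4) 0 = 2 * a2"
    by (rule DERIV_imp_deriv) (auto intro!: derivative_eq_intros)
  ultimately show ?thesis by simp
qed

context
  fixes B :: "real^'n^'n \<Rightarrow> real^'n^'n \<Rightarrow> real" and M :: "real^'n^'n" and X :: "real^'r^'n"
  assumes B: "bilinear B" "\<And>x y. B x y = B y x"
begin

lemma grad_zero_factored_iff:
  "grad_zero (\<lambda>U. B (U ** transpose U - M) (U ** transpose U - M)) X \<longleftrightarrow>
    (\<forall>H. B (X ** transpose X - M) (X ** transpose H + H ** transpose X) = 0)"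
proof -
  have bbm: "bounded_bilinear (\<lambda>(U :: real^'r^'n) (V :: real^'r^'n). U ** transpose V)"
    using bilinear_mult_transpose bilinear_conv_bounded_bilinear by blast
  have bbB: "bounded_bilinear B" using B(1) bilinear_conv_bounded_bilinear by blast
  have 1: "((\<lambda>U :: real^'r^'n. U ** transpose U) has_derivative
      (\<lambda>H. X ** transpose H + H ** transpose X)) (at X)"
    using bounded_bilinear.FDERIV[OF bbm has_derivative_ident has_derivative_ident] .
  have 2: "((\<lambda>U :: real^'r^'n. U ** transpose U - M) has_derivative
      (\<lambda>H. X ** transpose H + H ** transpose X)) (at X)"
    using has_derivative_diff[OF 1 has_derivative_const[of M]] by simp
  have 3: "((\<lambda>U. B (U ** transpose U - M) (U ** transpose U - M)) has_derivative
      (\<lambda>H. 2 * B (X ** transpose X - M) (X ** transpose H + H ** transpose X))) (at X)"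
    using bounded_bilinear.FDERIV[OF bbB 2 2] B(2)[of _ "X ** transpose X - M"] by simp
  show ?thesis
  proof
    assume "grad_zero (\<lambda>U. B (U ** transpose U - M) (U ** transpose U - M)) X"
    then have "(\<lambda>H. 0) = (\<lambda>H. 2 * B (X ** transpose X - M) (X ** transpose H + H ** transpose X))"
      unfolding grad_zero_def by (rule has_derivative_unique[OF _ 3])
    then show "\<forall>H. B (X ** transpose X - M) (X ** transpose H + H ** transpose X) = 0"
      by (simp add: fun_eq_iff)
  next
    assume "\<forall>H. B (X ** transpose X - M) (X ** transpose H + H ** transpose X) = 0"
    then show "grad_zero (\<lambda>U. B (U ** transpose U - M) (U ** transpose U - M)) X"
      unfolding grad_zero_def using 3 by simp
  qed
qed

lemma hess_psd_factored_iff: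
  "hess_psd (\<lambda>U. B (U ** transpose U - M) (U ** transpose U - M)) X \<longleftrightarrow>
    (\<forall>H. 0 \<le> B (X ** transpose H + H ** transpose X) (X ** transpose H + H ** transpose X)
      + 2 * B (X ** transpose X - M) (H ** transpose H))"
proof -
  have "deriv (deriv (\<lambda>t. B ((X + t *\<^sub>R H) ** transpose (X + t *\<^sub>R H) - M)
          ((X + t *\<^sub>R H) ** transpose (X + t *\<^sub>R H) - M))) 0 =
      2 * (B (X ** transpose H + H ** transpose X) (X ** transpose H + H ** transpose X)
        + 2 * B (X ** transpose X - M) (H ** transpose H))" for H
  proof -
    define E D S where "E = X ** transpose X - M" and "D = X ** transpose H + H ** transpose X"
      and "S = H ** transpose H"
    note m = bilinear_mult_transpose
    have expand: "(X + t *\<^sub>R H) ** transpose (X + t *\<^sub>R H) - M = E + t *\<^sub>R D + t^2 *\<^sub>R S" for t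
      by (simp add: E_def D_def S_def bilinear_ladd[OF m] bilinear_radd[OF m] bilinear_lmul[OF m]
          bilinear_rmul[OF m] power2_eq_square algebra_simps)
    have "B (E + t *\<^sub>R D + t^2 *\<^sub>R S) (E + t *\<^sub>R D + t^2 *\<^sub>R S) =
        B E E + t * (2 * B E D) + t^2 * (B D D + 2 * B E S) + t^3 * (2 * B D S) + t^4 * B S S" for t
      using B(2)[of D E] B(2)[of S E] B(2)[of S D]
      by (simp add: bilinear_ladd[OF B(1)] bilinear_radd[OF B(1)] bilinear_lmul[OF B(1)]
          bilinear_rmul[OF B(1)] power2_eq_square power3_eq_cube power4_eq_xxxx algebra_simps)
    then show ?thesis
      unfolding expand E_def[symmetric] D_def[symmetric] S_def[symmetric]
      by (simp only: deriv_deriv_quartic)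
  qed
  then show ?thesis
    unfolding hess_psd_def by (simp add: zero_le_mult_iff del: distrib_left_numeral)
qed

end

section \<open>Measurement operators below the threshold\<close>

lemma RIP_mono: "RIP \<delta> p q \<Longrightarrow> \<delta> \<le> \<delta>' \<Longrightarrow> \<delta>' < 1 \<Longrightarrow> RIP \<delta>' p q"
  unfolding RIP_def
  by (smt (verit) mult_right_mono zero_le_power2)

lemma second_order_point_iff_global_min:
  fixes A :: "real^'n^'n \<Rightarrow> 'm::euclidean_space" and X :: "real^'r^'n"
  assumes A: "linear A" and M: "psd M" "rank M \<le> CARD('r)"
    and rip: "RIP \<delta> (CARD('r) + rank M) (\<lambda>E. (norm (A E))^2)"
    and \<delta>: "\<delta> < 1 / (1 + sqrt (real (rank M) / real CARD('r)))"
  defines "f \<equiv> \<lambda>U :: real^'r^'n. (norm (A (U ** transpose U) - A M))^2"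
  shows "grad_zero f X \<and> hess_psd f X \<longleftrightarrow> X ** transpose X = M"
proof -
  let ?B = "\<lambda>F F'. A F \<bullet> A F'"
  have B: "bilinear ?B" by (rule bilinear_inner_linear[OF A A])
  have f: "f = (\<lambda>U. ?B (U ** transpose U - M) (U ** transpose U - M))"
    by (simp add: f_def linear_diff[OF A] power2_norm_eq_inner)
  have iff: "grad_zero f X \<and> hess_psd f X \<longleftrightarrow>
      (\<forall>H. ?B (X ** transpose X - M) (X ** transpose H + H ** transpose X) = 0) \<and>
      (\<forall>H. 0 \<le> ?B (X ** transpose H + H ** transpose X) (X ** transpose H + H ** transpose X)
        + 2 * ?B (X ** transpose X - M) (H ** transpose H))"
    unfolding f grad_zero_factored_iff[OF B inner_commute] hess_psd_factored_iff[OF B inner_commute] ..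
  show ?thesis
  proof
    assume "X ** transpose X = M"
    then show "grad_zero f X \<and> hess_psd f X" unfolding iff by (simp add: linear_0[OF A])
  next
    assume *: "grad_zero f X \<and> hess_psd f X"
    let ?t = "1 / (1 + sqrt (real (rank M) / real CARD('r)))"
    have "?t \<le> 1" by (simp add: divide_le_eq_1 add_pos_nonneg)
    moreover have "0 \<le> \<delta>" using rip by (simp add: RIP_def)
    \<comment> \<open>The constant is enlarged slightly within the open range, because the argument
      uses multiples \<open>\<delta> G\<close> and needs a positive constant while
      \<open>\<delta> = 0\<close> is allowed.\<close>
    moreover obtain \<delta>' where \<delta>': "\<delta> < \<delta>'" "\<delta>' < ?t" using dense[OF \<delta>] by blast
    ultimately have \<delta>'01: "0 < \<delta>'" "\<delta>' < 1" by linarith+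
    have "RIP \<delta>' (CARD('r) + rank M) (\<lambda>E. (norm (A E))^2)"
      using RIP_mono[OF rip] \<delta>' \<delta>'01 by simp
    then obtain \<nu> where \<nu>: "0 < \<nu>" and rip': "\<And>E. rank E \<le> CARD('r) + rank M \<Longrightarrow>
        (1 - \<delta>') * (norm E)^2 \<le> (norm (A E))^2 / \<nu> \<and> (norm (A E))^2 / \<nu> \<le> (1 + \<delta>') * (norm E)^2"
      unfolding RIP_def by blast
    let ?B' = "\<lambda>F F'. A F \<bullet> A F' / \<nu>"
    have B': "bilinear ?B'"
      using B by (auto simp: bilinear_def linear_iff inner_add_left inner_add_right add_divide_distrib)
    show "X ** transpose X = M"
    proof (rule no_spurious_second_order_point[OF B' _ M \<delta>'01 \<delta>'(2)])
      show "(1 - \<delta>') * (norm F)^2 \<le> ?B' F F \<and> ?B' F F \<le> (1 + \<delta>') * (norm F)^2"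
        if "rank F \<le> CARD('r) + rank M" for F
        using rip'[OF that] by (simp add: power2_norm_eq_inner)
      show "?B' (X ** transpose X - M) (X ** transpose V + V ** transpose X) = 0" for V
        using * unfolding iff by simp
      show "0 \<le> ?B' (X ** transpose V + V ** transpose X) (X ** transpose V + V ** transpose X)
          + 2 * ?B' (X ** transpose X - M) (V ** transpose V)" for V
      proof -
        have "0 \<le> (?B (X ** transpose V + V ** transpose X) (X ** transpose V + V ** transpose X)
          + 2 * ?B (X ** transpose X - M) (V ** transpose V)) / \<nu>"
          using * \<nu> unfolding iff by simp
        then show ?thesis by (simp add: add_divide_distrib)
      qed
    qed (simp add: inner_commute)
  qed
qed

section \<open>Diagonal matrices and sensing matrices\<close>

definition diagm :: "('n \<Rightarrow> real) \<Rightarrow> real^'n^'n" where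
  "diagm h = (\<chi> i j. if i = j then h i else 0)"

lemma diagm_vector_mult: "diagm h *v x = (\<chi> i. h i * x $ i)"
proof -
  have "(\<Sum>j\<in>UNIV. (if i = j then h i else 0) * x $ j) = h i * x $ i" for i
  proof -
    have "(\<Sum>j\<in>UNIV. (if i = j then h i else 0) * x $ j) = (\<Sum>j\<in>UNIV. if i = j then h i * x $ i else 0)"
      by (rule sum.cong) auto
    then show ?thesis by simp
  qed
  then show ?thesis by (simp add: diagm_def matrix_vector_mult_def vec_eq_iff)
qed

lemma inner_diagm: "diagm h \<bullet> F = (\<Sum>i\<in>UNIV. h i * F $ i $ i)"
proof -
  have "(\<Sum>j\<in>UNIV. (if i = j then h i else 0) * F $ i $ j) = h i * F $ i $ i" for i
  proof -
    have "(\<Sum>j\<in>UNIV. (if i = j then h i else 0) * F $ i $ j) = (\<Sum>j\<in>UNIV. if i = j then h i * F $ i $ i else 0)"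
      by (rule sum.cong) auto
    then show ?thesis by simp
  qed
  then show ?thesis by (simp add: diagm_def inner_vec_def)
qed

lemma psd_diagm: "(\<And>i. 0 \<le> h i) \<Longrightarrow> psd (diagm h)"
  unfolding psd_def diagm_vector_mult
  by (simp add: diagm_def transpose_def vec_eq_iff inner_vec_def mult.left_commute sum_nonneg)

lemma rank_diagm: "rank (diagm h) = card {i. h i \<noteq> 0}"
proof -
  let ?B = "(\<lambda>i. axis i (1::real)) ` {i. h i \<noteq> 0}"
  have "range (\<lambda>x. diagm h *v x) = span ?B"
  proof (intro antisym subsetI)
    fix y assume "y \<in> range (\<lambda>x. diagm h *v x)"
    then obtain x where y: "y = diagm h *v x" by auto
    have "y = (\<Sum>i\<in>UNIV. (h i * x $ i) *\<^sub>R axis i 1)"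
      unfolding y diagm_vector_mult
      by (simp add: vec_eq_iff axis_def if_distrib[of "\<lambda>a. _ * a"] cong: if_cong)
    also have "\<dots> \<in> span ?B"
    proof (rule span_sum)
      fix i show "(h i * x $ i) *\<^sub>R axis i 1 \<in> span ?B"
        by (cases "h i = 0") (simp_all add: span_zero span_scale span_base)
    qed
    finally show "y \<in> span ?B" .
  next
    fix y assume "y \<in> span ?B"
    moreover have "subspace (range (\<lambda>x. diagm h *v x))"
      by (intro linear_subspace_image subspace_UNIV) simp
    moreover have "?B \<subseteq> range (\<lambda>x. diagm h *v x)"
    proof clarify
      fix i assume "h i \<noteq> 0"
      then have "axis i 1 = diagm h *v axis i (1 / h i)"
        by (auto simp: diagm_vector_mult vec_eq_iff axis_def)
      then show "axis i 1 \<in> range (\<lambda>x. diagm h *v x)" by blast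
    qed
    ultimately show "y \<in> range (\<lambda>x. diagm h *v x)" using span_minimal by blast
  qed
  then have "rank (diagm h) = dim ?B" by (simp add: rank_dim_range)
  also have "\<dots> = card ?B"
    by (rule dim_eq_card_independent)
      (rule independent_mono[OF independent_Basis], auto simp: Basis_vec_def)
  also have "\<dots> = card {i. h i \<noteq> 0}"
    by (rule card_image) (auto simp: inj_on_def axis_eq_axis)
  finally show ?thesis .
qed

text \<open>The sensing matrices are the images \<open>C (b i)\<close> of an orthonormal basis: by
  self-adjointness their inner products with \<open>F\<close> are the coordinates of
  \<open>C F\<close>.\<close>

lemma meas_sq_exists:
  fixes C :: "real^'n^'n \<Rightarrow> real^'n^'n"
  assumes "\<And>F F'. C F \<bullet> F' = F \<bullet> C F'"
  obtains m As where "meas_sq m As = (\<lambda>F. (norm (C F))^2)"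
proof -
  obtain b where b: "bij_betw b {0..<card (Basis :: (real^'n^'n) set)} (Basis :: (real^'n^'n) set)"
    using ex_bij_betw_nat_finite[OF finite_Basis] by blast
  show ?thesis
  proof
    show "meas_sq (card (Basis :: (real^'n^'n) set)) (\<lambda>i. C (b i)) = (\<lambda>F. (norm (C F))^2)"
    proof
      fix F
      have "meas_sq (card (Basis :: (real^'n^'n) set)) (\<lambda>i. C (b i)) F =
          (\<Sum>i\<in>{0..<card (Basis :: (real^'n^'n) set)}. (C F \<bullet> b i)^2)"
        unfolding meas_sq_def lessThan_atLeast0
        by (rule sum.cong) (simp_all add: assms inner_commute)
      also have "\<dots> = (\<Sum>u\<in>Basis. (C F \<bullet> u)^2)"
        by (rule sum.reindex_bij_betw[OF b])
      also have "\<dots> = (norm (C F))^2"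
        unfolding power2_norm_eq_inner euclidean_inner[of "C F" "C F"] by (simp add: power2_eq_square)
      finally show "meas_sq (card (Basis :: (real^'n^'n) set)) (\<lambda>i. C (b i)) F = (norm (C F))^2" .
    qed
  qed
qed

lemma inner_square_le: "(x \<bullet> y)\<^sup>2 \<le> (norm x)\<^sup>2 * (norm (y::'a::real_inner))\<^sup>2"
  using Cauchy_Schwarz_ineq[of x y] by (simp add: power2_norm_eq_inner)

text \<open>The sensing matrices come from the operator \<open>F \<mapsto> \<alpha> F - ((\<alpha> - 1) / 2) (\<pi> \<bullet> F) \<pi>\<close> with
  \<open>\<alpha> = sqrt (1 + 2 \<kappa>)\<close>, the square root of the operator representing this quadratic form.\<close>
lemma rank_one_perturbation_meas_sq:
  fixes \<pi> :: "real^'n^'n"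
  assumes \<kappa>: "0 \<le> \<kappa>" and \<pi>: "\<pi> \<bullet> \<pi> = 2"
  obtains m As where "meas_sq m As = (\<lambda>F. (1 + 2 * \<kappa>) * (F \<bullet> F) - \<kappa> * ((\<pi> \<bullet> F) * (\<pi> \<bullet> F)))"
proof -
  define \<alpha> where "\<alpha> = sqrt (1 + 2 * \<kappa>)"
  have \<alpha>: "\<alpha> * \<alpha> = 1 + 2 * \<kappa>" using \<kappa> by (simp add: \<alpha>_def)
  define C where "C = (\<lambda>F. \<alpha> *\<^sub>R F - ((\<alpha> - 1) / 2 * (\<pi> \<bullet> F)) *\<^sub>R \<pi>)"
  have "C F \<bullet> F' = F \<bullet> C F'" for F F'
    by (simp add: C_def inner_diff_left inner_diff_right inner_commute[of F \<pi>])
  then obtain m As where m: "meas_sq m As = (\<lambda>F. (norm (C F))^2)" by (rule meas_sq_exists)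
  have "(norm (C F))^2 = (1 + 2 * \<kappa>) * (F \<bullet> F) - \<kappa> * ((\<pi> \<bullet> F) * (\<pi> \<bullet> F))" for F
  proof -
    have "(norm (C F))^2 = \<alpha> * \<alpha> * (F \<bullet> F) - (\<alpha> * \<alpha> - 1) / 2 * ((\<pi> \<bullet> F) * (\<pi> \<bullet> F))"
      by (simp add: C_def power2_norm_eq_inner inner_diff_left inner_diff_right inner_commute[of F \<pi>] \<pi>)
        (simp add: field_simps)
    then show ?thesis unfolding \<alpha> by simp
  qed
  then show ?thesis using that m by simp
qed

section \<open>The counterexample from the second threshold on\<close>

text \<open>The rank bound \<open>p\<close> is arbitrary because the form constructed here satisfies
  the isometry bounds on all matrices.\<close>

lemma spurious_second_order_point:
  fixes \<delta> :: real
  assumes card: "CARD('r) < CARD('n)" and rs: "1 \<le> rs" "rs \<le> CARD('r)"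
    and \<delta>: "1 / (1 + 1 / sqrt (real (CARD('r) - rs + 1))) \<le> \<delta>" "\<delta> < 1"
  shows "\<exists>m As (M :: real^'n^'n) (X :: real^'r^'n). RIP \<delta> p (meas_sq m As) \<and>
     psd M \<and> rank M = rs \<and> X ** transpose X \<noteq> M \<and>
     0 < meas_sq m As (X ** transpose X - M) \<and>
     grad_zero (\<lambda>U :: real^'r^'n. meas_sq m As (U ** transpose U - M)) X \<and>
     hess_psd (\<lambda>U :: real^'r^'n. meas_sq m As (U ** transpose U - M)) X"
proof -
  \<comment> \<open>\<open>k\<close> counts the coordinates in the range of \<open>X\<close> that
    \<open>M\<close> does not use; \<open>M\<close> uses the other \<open>rs - 1\<close> of them and
    the outside coordinate \<open>j0\<close>.\<close>
  define k where "k = CARD('r) - rs + 1"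
  define \<kappa> where "\<kappa> = sqrt (real k)"
  have k: "1 \<le> k" "k \<le> CARD('r)" using rs by (auto simp: k_def)
  have \<kappa>: "0 < \<kappa>" "\<kappa> * \<kappa> = real k" using k by (auto simp: \<kappa>_def)
  have "\<exists>\<iota> :: 'r \<Rightarrow> 'n. inj \<iota>"
    using card_le_inj[of "UNIV :: 'r set" "UNIV :: 'n set"] card by auto
  then obtain \<iota> :: "'r \<Rightarrow> 'n" where \<iota>: "inj \<iota>" by blast
  have "range \<iota> \<noteq> UNIV" using card card_image[OF \<iota>] by (metis less_irrefl)
  then obtain j0 where j0: "j0 \<notin> range \<iota>" by blast
  obtain R :: "'r set" where R: "card R = k" using obtain_subset_with_card_n[OF k(2)] by metis
  define X :: "real^'r^'n" where "X = (\<chi> i j. if i = \<iota> j then 1 else 0)"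
  define h where "h = (\<lambda>i. (if i = j0 then 1 + \<kappa> else 0) + (if i \<in> \<iota> ` (- R) then 1 else 0 :: real))"
  define M where "M = diagm h"
  \<comment> \<open>\<open>\<pi>\<close> is chosen such that \<open>E - \<kappa> \<pi>\<close> has
    the single entry -1 at \<open>j0\<close>. Together with
    \<open>\<pi> \<bullet> E = 1 + 2 \<kappa>\<close> this makes \<open>B E F\<close> a multiple of
    the entry of \<open>F\<close> at \<open>j0\<close>, which vanishes in tangent directions as row
    \<open>j0\<close> of \<open>X\<close> is zero.\<close>
  define l where "l = (\<lambda>i. (if i \<in> \<iota> ` R then 1 / \<kappa> else 0) - (if i = j0 then 1 else 0 :: real))"
  define \<pi> where "\<pi> = diagm l"
  define e where "e = (\<lambda>i. (if i \<in> \<iota> ` R then 1 else 0) - (if i = j0 then 1 + \<kappa> else 0 :: real))"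
  have cardR: "card (\<iota> ` R) = k" using R \<iota> by (simp add: card_image inj_on_subset)
  have j0': "j0 \<notin> \<iota> ` S" for S using j0 by auto
  have XX: "X ** transpose X - M = diagm e"
  proof -
    have "(\<Sum>j\<in>UNIV. (if i = \<iota> j then 1 else 0) * (if i' = \<iota> j then 1 else 0)) =
        (if i = i' \<and> i \<in> range \<iota> then 1 else 0 :: real)" for i i'
    proof (cases "i \<in> range \<iota>")
      case True
      then obtain j where j: "i = \<iota> j" by blast
      have "(\<Sum>j\<in>UNIV. (if i = \<iota> j then 1 else 0) * (if i' = \<iota> j then 1 else 0)) =
          (\<Sum>j'\<in>UNIV. if j' = j then (if i' = i then 1 else 0 :: real) else 0)"
        by (rule sum.cong) (use \<iota> j in \<open>auto simp: inj_eq\<close>)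
      then show ?thesis using True by auto
    next
      case False
      then have "(\<Sum>j\<in>UNIV. (if i = \<iota> j then 1 else 0) * (if i' = \<iota> j then 1 else 0)) = (\<Sum>j\<in>(UNIV::'r set). 0 :: real)"
        by (intro sum.cong) auto
      then show ?thesis using False by simp
    qed
    moreover have "e i = (if i \<in> range \<iota> then 1 else 0) - h i" for i
    proof (cases "i \<in> range \<iota>")
      case True
      then obtain j where "i = \<iota> j" by blast
      then show ?thesis using j0 by (auto simp: e_def h_def inj_image_mem_iff[OF \<iota>])
    next
      case False
      then have "i \<notin> \<iota> ` S" for S by blast
      then show ?thesis using False by (simp add: e_def h_def)
    qed
    ultimately show ?thesis
      by (simp add: X_def M_def diagm_def matrix_matrix_mult_def transpose_def vec_eq_iff)
  qed
  have "{i. h i \<noteq> 0} = insert j0 (\<iota> ` (- R))" using \<kappa> j0' by (auto simp: h_def)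
  moreover have "card (\<iota> ` (- R)) = CARD('r) - k"
    using \<iota> R by (simp add: card_image inj_on_subset Compl_eq_Diff_UNIV card_Diff_subset)
  ultimately have rankM: "rank M = rs"
    using j0' rs k by (simp add: M_def rank_diagm k_def)
  have psdM: "psd M" unfolding M_def by (rule psd_diagm) (use \<kappa> in \<open>auto simp: h_def\<close>)
  have sumR: "(\<Sum>i\<in>UNIV. if i \<in> \<iota> ` R then c else 0) = real k * c" for c :: real
    by (simp add: sum.If_cases cardR)
  have \<pi>2: "\<pi> \<bullet> \<pi> = 2"
  proof -
    have "\<pi> \<bullet> \<pi> = (\<Sum>i\<in>UNIV. (if i \<in> \<iota> ` R then 1 / \<kappa> * (1 / \<kappa>) else 0) + (if i = j0 then 1 else 0))"
      unfolding \<pi>_def inner_diagm by (rule sum.cong) (use j0' in \<open>auto simp: diagm_def l_def\<close>)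
    then have "\<pi> \<bullet> \<pi> = real k * (1 / \<kappa> * (1 / \<kappa>)) + 1"
      unfolding sum.distrib sumR by simp
    then show ?thesis using \<kappa>(1) unfolding \<kappa>(2)[symmetric] by simp
  qed
  have \<pi>E: "\<pi> \<bullet> diagm e = 1 + 2 * \<kappa>"
  proof -
    have "\<pi> \<bullet> diagm e = (\<Sum>i\<in>UNIV. (if i \<in> \<iota> ` R then 1 / \<kappa> else 0) + (if i = j0 then 1 + \<kappa> else 0))"
      unfolding \<pi>_def inner_diagm by (rule sum.cong) (use j0' in \<open>auto simp: diagm_def l_def e_def\<close>)
    then have "\<pi> \<bullet> diagm e = real k * (1 / \<kappa>) + (1 + \<kappa>)"
      unfolding sum.distrib sumR by simp
    then show ?thesis using \<kappa>(1) unfolding \<kappa>(2)[symmetric] by simp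
  qed
  define B where "B = (\<lambda>F F'. (1 + 2 * \<kappa>) * (F \<bullet> F') - \<kappa> * ((\<pi> \<bullet> F) * (\<pi> \<bullet> F')))"
  have B: "bilinear B"
    by (auto simp: B_def bilinear_def linear_iff inner_add_left inner_add_right algebra_simps)
  have Bc: "B F F' = B F' F" for F F' by (simp add: B_def inner_commute[of F F'] mult_ac)
  obtain m As where As: "meas_sq m As = (\<lambda>F. B F F)"
    using rank_one_perturbation_meas_sq[OF less_imp_le[OF \<kappa>(1)] \<pi>2] unfolding B_def by metis
  have BE: "B (diagm e) F = - ((1 + 2 * \<kappa>) * F $ j0 $ j0)" for F
  proof -
    have "diagm e \<bullet> F - \<kappa> * (\<pi> \<bullet> F) = (\<Sum>i\<in>UNIV. if i = j0 then - F $ j0 $ j0 else 0)"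
      unfolding \<pi>_def inner_diagm sum_distrib_left sum_subtractf[symmetric]
      by (rule sum.cong) (use \<kappa> j0' in \<open>auto simp: e_def l_def algebra_simps\<close>)
    then have *: "diagm e \<bullet> F - \<kappa> * (\<pi> \<bullet> F) = - F $ j0 $ j0" by simp
    have "B (diagm e) F = (1 + 2 * \<kappa>) * (diagm e \<bullet> F - \<kappa> * (\<pi> \<bullet> F))"
      by (simp add: B_def \<pi>E algebra_simps)
    then show ?thesis unfolding * by simp
  qed
  have Xj0: "X $ j0 $ j = 0" for j using j0 by (auto simp: X_def)
  have pos: "0 < B (diagm e) (diagm e)"
  proof -
    have "B (diagm e) (diagm e) = (1 + 2 * \<kappa>) * (1 + \<kappa>)"
      using j0' by (simp add: BE) (simp add: diagm_def e_def algebra_simps)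
    then show ?thesis using \<kappa>(1) by simp
  qed
  have first: "B (X ** transpose X - M) (X ** transpose H + H ** transpose X) = 0" for H
    unfolding XX BE by (simp add: matrix_matrix_mult_def transpose_def Xj0)
  have second: "0 \<le> B (X ** transpose H + H ** transpose X) (X ** transpose H + H ** transpose X)
      + 2 * B (X ** transpose X - M) (H ** transpose H)" for H
  proof -
    define D where "D = X ** transpose H + H ** transpose X"
    have Dsym: "D $ i $ j = D $ j $ i" for i j
      by (simp add: D_def matrix_matrix_mult_def transpose_def mult.commute add.commute)
    have Dj: "D $ j0 $ \<iota> j = H $ j0 $ j" for j
    proof -
      have "D $ j0 $ \<iota> j = (\<Sum>j'\<in>UNIV. H $ j0 $ j' * X $ \<iota> j $ j')"
        by (simp add: D_def matrix_matrix_mult_def transpose_def Xj0)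
      also have "\<dots> = (\<Sum>j'\<in>UNIV. if j' = j then H $ j0 $ j else 0)"
        by (rule sum.cong) (use \<iota> in \<open>auto simp: X_def inj_eq\<close>)
      finally show ?thesis by simp
    qed
    \<comment> \<open>The negative curvature is \<open>2 (1 + 2 \<kappa>) v\<close>. The entries of
      row \<open>j0\<close> of \<open>H\<close> occur in \<open>D\<close> off the diagonal and twice
      by symmetry, contributing \<open>2 v\<close> to \<open>D \<bullet> D\<close>; the diagonal
      \<open>\<pi>\<close> only sees the part \<open>s\<close>.\<close>
    define s where "s = (\<Sum>i\<in>UNIV. (D $ i $ i)^2)"
    define v where "v = (\<Sum>j\<in>UNIV. (H $ j0 $ j)^2)"
    have \<pi>s: "(\<pi> \<bullet> D)^2 \<le> 2 * s"
    proof -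
      define D' where "D' = diagm (\<lambda>i. D $ i $ i)"
      have "\<pi> \<bullet> D = \<pi> \<bullet> D'" by (simp add: \<pi>_def inner_diagm D'_def) (simp add: diagm_def)
      moreover have "D' \<bullet> D' = s"
        by (simp add: D'_def inner_diagm s_def) (simp add: diagm_def power2_eq_square)
      ultimately show ?thesis using inner_square_le[of \<pi> D'] \<pi>2 by (simp add: power2_norm_eq_inner)
    qed
    have Ds: "s + 2 * v \<le> D \<bullet> D"
    proof -
      have row: "(\<Sum>l\<in>UNIV. (D $ i $ l)^2) = (D $ i $ i)^2 + (\<Sum>l\<in>-{i}. (D $ i $ l)^2)" for i
        by (subst sum.remove[of UNIV i]) (auto simp: Compl_eq_Diff_UNIV)
      have vle: "v \<le> (\<Sum>l\<in>-{j0}. (D $ j0 $ l)^2)"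
      proof -
        have "v = (\<Sum>l\<in>range \<iota>. (D $ j0 $ l)^2)"
          unfolding v_def by (simp add: sum.reindex[OF \<iota>] Dj)
        also have "\<dots> \<le> (\<Sum>l\<in>-{j0}. (D $ j0 $ l)^2)"
          by (rule sum_mono2) (use j0 in auto)
        finally show ?thesis .
      qed
      have "(\<Sum>l\<in>-{j0}. (D $ j0 $ l)^2) \<le> (\<Sum>i\<in>-{j0}. \<Sum>l\<in>-{i}. (D $ i $ l)^2)"
      proof (rule sum_mono)
        fix i assume "i \<in> - {j0}"
        then have "(D $ i $ j0)^2 \<le> (\<Sum>l\<in>-{i}. (D $ i $ l)^2)"
          by (intro member_le_sum) auto
        then show "(D $ j0 $ i)^2 \<le> (\<Sum>l\<in>-{i}. (D $ i $ l)^2)" by (simp only: Dsym[of j0 i])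
      qed
      moreover have "(\<Sum>i\<in>UNIV. \<Sum>l\<in>-{i}. (D $ i $ l)^2) =
          (\<Sum>l\<in>-{j0}. (D $ j0 $ l)^2) + (\<Sum>i\<in>-{j0}. \<Sum>l\<in>-{i}. (D $ i $ l)^2)"
        by (subst sum.remove[of UNIV j0]) (auto simp: Compl_eq_Diff_UNIV)
      ultimately have "2 * v \<le> (\<Sum>i\<in>UNIV. \<Sum>l\<in>-{i}. (D $ i $ l)^2)" using vle by linarith
      moreover have "D \<bullet> D = s + (\<Sum>i\<in>UNIV. \<Sum>l\<in>-{i}. (D $ i $ l)^2)"
        by (simp add: inner_vec_def row s_def sum.distrib flip: power2_eq_square)
      ultimately show ?thesis by linarith
    qed
    have "(H ** transpose H) $ j0 $ j0 = v"
      by (simp add: matrix_matrix_mult_def transpose_def v_def power2_eq_square)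
    then have BH: "B (X ** transpose X - M) (H ** transpose H) = - ((1 + 2 * \<kappa>) * v)"
      unfolding XX BE by simp
    have "0 \<le> s" by (simp add: s_def sum_nonneg)
    moreover have "\<kappa> * (\<pi> \<bullet> D)^2 \<le> \<kappa> * (2 * s)"
      using \<kappa> by (intro mult_left_mono[OF \<pi>s]) simp
    ultimately have "\<kappa> * (\<pi> \<bullet> D)^2 \<le> (1 + 2 * \<kappa>) * s"
      by (simp add: distrib_right mult.assoc)
    moreover have "(1 + 2 * \<kappa>) * (s + 2 * v) \<le> (1 + 2 * \<kappa>) * (D \<bullet> D)"
      using Ds \<kappa> by (intro mult_left_mono) auto
    ultimately have "2 * ((1 + 2 * \<kappa>) * v) \<le> B D D"
      by (simp add: B_def power2_eq_square algebra_simps)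
    then show ?thesis unfolding D_def[symmetric] BH by simp
  qed
  have "RIP \<delta> p (meas_sq m As)"
    unfolding RIP_def
  proof (intro conjI exI allI impI)
    have t: "1 / (1 + 1 / sqrt (real (CARD('r) - rs + 1))) = \<kappa> / (1 + \<kappa>)"
      using \<kappa>(1) unfolding k_def[symmetric] \<kappa>_def[symmetric] by (simp add: field_simps)
    have d: "\<kappa> \<le> \<delta> * (1 + \<kappa>)" using \<delta>(1) \<kappa>(1) unfolding t by (simp add: pos_divide_le_eq)
    have "0 < \<kappa> / (1 + \<kappa>)" using \<kappa> by simp
    then show "0 \<le> \<delta>" using \<delta>(1) unfolding t by linarith
    \<comment> \<open>The scaling factor is \<open>1 + \<kappa>\<close>, the midpoint of the extreme
      eigenvalues 1 and \<open>1 + 2 \<kappa>\<close> of the form. Their relative deviation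
      \<open>\<kappa> / (1 + \<kappa>)\<close> is the threshold.\<close>
    show "\<delta> < 1" "1 + \<kappa> > 0" using \<delta>(2) \<kappa>(1) by auto
    fix F :: "real^'n^'n"
    have pi: "\<kappa> * (\<pi> \<bullet> F)^2 \<le> \<kappa> * (2 * (norm F)^2)"
      using inner_square_le[of \<pi> F] \<pi>2 \<kappa> by (intro mult_left_mono) (auto simp: power2_norm_eq_inner)
    have BF: "B F F = (1 + 2 * \<kappa>) * (norm F)^2 - \<kappa> * (\<pi> \<bullet> F)^2"
      by (simp add: B_def flip: power2_norm_eq_inner power2_eq_square)
    have "((1 - \<delta>) * (1 + \<kappa>)) * (norm F)^2 \<le> 1 * (norm F)^2"
      using d by (intro mult_right_mono) (auto simp: algebra_simps)
    also have "\<dots> \<le> B F F" unfolding BF using pi by (simp add: algebra_simps)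
    finally show "(1 - \<delta>) * (norm F)^2 \<le> meas_sq m As F / (1 + \<kappa>)"
      unfolding As using \<kappa> by (simp add: pos_le_divide_eq mult_ac)
    have "B F F \<le> (1 + 2 * \<kappa>) * (norm F)^2" unfolding BF using \<kappa> by simp
    also have "\<dots> \<le> ((1 + \<delta>) * (1 + \<kappa>)) * (norm F)^2"
      using d by (intro mult_right_mono) (auto simp: algebra_simps)
    finally show "meas_sq m As F / (1 + \<kappa>) \<le> (1 + \<delta>) * (norm F)^2"
      unfolding As using \<kappa> by (simp add: pos_divide_le_eq mult_ac)
  qed
  moreover have "X ** transpose X \<noteq> M"
    using pos XX bilinear_lzero[OF B] by (metis right_minus_eq less_irrefl)
  moreover have "0 < meas_sq m As (X ** transpose X - M)" unfolding As XX by (rule pos)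
  moreover have "grad_zero (\<lambda>U :: real^'r^'n. meas_sq m As (U ** transpose U - M)) X"
    unfolding As grad_zero_factored_iff[OF B Bc] using first by blast
  moreover have "hess_psd (\<lambda>U :: real^'r^'n. meas_sq m As (U ** transpose U - M)) X"
    unfolding As hess_psd_factored_iff[OF B Bc] using second by blast
  ultimately show ?thesis using psdM rankM by blast
qed

theorem theorem2:
  assumes "CARD('r) < CARD('n)"
  shows
  "(\<forall>(A :: real^'n^'n \<Rightarrow> 'm::euclidean_space) (Mstar :: real^'n^'n) (\<delta>::real) (X :: real^'r^'n).
      linear A \<and> psd Mstar \<and> rank Mstar \<le> CARD('r) \<and>
      RIP \<delta> (CARD('r) + rank Mstar) (\<lambda>E. (norm (A E))^2) \<and>
      \<delta> < 1 / (1 + sqrt (real (rank Mstar) / real CARD('r)))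
      \<longrightarrow>
      (let b = A Mstar; f = (\<lambda>U :: real^'r^'n. (norm (A (U ** transpose U) - b))^2) in
        (grad_zero f X \<and> hess_psd f X \<longleftrightarrow> X ** transpose X = Mstar)))
   \<and>
   (\<forall>(rs::nat) (\<delta>::real).
      1 \<le> rs \<and> rs \<le> CARD('r) \<and>
      1 / (1 + 1 / sqrt (real (CARD('r) - rs + 1))) \<le> \<delta> \<and> \<delta> < 1
      \<longrightarrow>
      (\<exists>(m::nat) (As :: nat \<Rightarrow> real^'n^'n) (Mstar :: real^'n^'n) (X :: real^'r^'n).
         RIP \<delta> (CARD('r) + rs) (meas_sq m As) \<and>
         psd Mstar \<and> rank Mstar = rs \<and> X ** transpose X \<noteq> Mstar \<and>
         (let f = (\<lambda>U :: real^'r^'n. meas_sq m As (U ** transpose U - Mstar)) in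
           0 < f X \<and> grad_zero f X \<and> hess_psd f X)))"
  unfolding Let_def
proof (intro conjI allI impI)
  fix A :: "real^'n^'n \<Rightarrow> 'm" and Mstar :: "real^'n^'n" and \<delta> and X :: "real^'r^'n"
  assume "linear A \<and> psd Mstar \<and> rank Mstar \<le> CARD('r) \<and>
      RIP \<delta> (CARD('r) + rank Mstar) (\<lambda>E. (norm (A E))^2) \<and>
      \<delta> < 1 / (1 + sqrt (real (rank Mstar) / real CARD('r)))"
  then show "grad_zero (\<lambda>U :: real^'r^'n. (norm (A (U ** transpose U) - A Mstar))^2) X \<and>
      hess_psd (\<lambda>U :: real^'r^'n. (norm (A (U ** transpose U) - A Mstar))^2) X \<longleftrightarrow>
      X ** transpose X = Mstar"
    using second_order_point_iff_global_min by blast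
next
  fix rs \<delta>
  assume "1 \<le> rs \<and> rs \<le> CARD('r) \<and>
      1 / (1 + 1 / sqrt (real (CARD('r) - rs + 1))) \<le> \<delta> \<and> \<delta> < 1"
  then show "\<exists>m As (Mstar :: real^'n^'n) (X :: real^'r^'n).
         RIP \<delta> (CARD('r) + rs) (meas_sq m As) \<and>
         psd Mstar \<and> rank Mstar = rs \<and> X ** transpose X \<noteq> Mstar \<and>
           0 < meas_sq m As (X ** transpose X - Mstar) \<and>
           grad_zero (\<lambda>U :: real^'r^'n. meas_sq m As (U ** transpose U - Mstar)) X \<and>
           hess_psd (\<lambda>U :: real^'r^'n. meas_sq m As (U ** transpose U - Mstar)) X"
    using spurious_second_order_point[OF assms] by blast
qed

end
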